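(* Let $T>0$, let $a<b$ be real numbers and let $\alpha\in[0,1)$. Let $c:\mathbb{R}\to\mathbb{R}$ be a Lipschitz continuous, differentiable function for which there are constants $C_1,C_2,M_1>0$ with $C_1\le c\le C_2$ and $0\le c'\le M_1$ on $\mathbb{R}$. Let $u_0\in H^1(\mathbb{R})$, $v_0\in L^2(\mathbb{R})$, and assume that $R_0=v_0+c(u_0)u_0'$ and $S_0=v_0-c(u_0)u_0'$ are nonpositive and in $L^1(\mathbb{R})\cap L^2(\mathbb{R})$. Then there is a constant $C_{\alpha,T,a,b}$, independent of $\Delta x$, such that the solution of the semi-discrete scheme described in the context satisfies $$\int_0^T\Delta x\sum_{j=j_a}^{j_b}c'(u_j^+)\,\big|D_+u_{j-1/2}\big|^{2+\alpha}\,dt\le C_{\alpha,T,a,b},$$ where $j_a\Delta x\in[a-1,a)$ and $j_b\Delta x\in(b,b+1]$.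
   Context: **The scheme.** Let $\Delta x>0$, $x_j=j\Delta x$, $x_{j+1/2}=x_j+\frac12\Delta x$, $I_j=[x_{j-1/2},x_{j+1/2})$, $j\in\mathbb{Z}$, and $D_\pm K_j=\pm\frac1{\Delta x}(K_{j\pm1}-K_j)$. Put $F(u)=\int_0^u2c(v)\,dv$ (a bijection of $\mathbb{R}$). For absolutely summable sequences $\{R_j\},\{S_j\}$ put $F_{j+1/2}=\Delta x\sum_{i\le j}(R_i-S_i)$, $u_{j+1/2}=F^{-1}(F_{j+1/2})$ and $c_{j+1/2}=c(u_{j+1/2})$. By the mean value theorem choose $\bar u_j^+$ and $u_j^+$ between $u_{j-1/2}$ and $u_{j+1/2}$ with $R_j-S_j=2c(\bar u_j^+)D_+u_{j-1/2}$ and $D_+c_{j-1/2}=c'(u_j^+)D_+u_{j-1/2}$, and set $\tilde c_j=\frac{c'(u_j^+)}{4c(\bar u_j^+)}$; thus $D_+c_{j-1/2}=2\tilde c_j(R_j-S_j)$. The scheme is the system of ordinary differential equations, for $j\in\mathbb{Z}$, $$R_j'(t)-c_{j+1/2}(t)D_+R_j(t)=\tilde c_j(t)(R_j^2(t)-S_j^2(t)),$$ $$S_j'(t)+c_{j-1/2}(t)D_-S_j(t)=-\tilde c_j(t)(R_j^2(t)-S_j^2(t)),$$ for $\ell^1(\mathbb{Z})$-valued $\{R_j(t)\},\{S_j(t)\}$, with initial values $$R_j(0)=v_{0,j}+c(u_{0,j})u_{0,j}',\quad S_j(0)=v_{0,j}-c(u_{0,j})u_{0,j}',$$ where $u_{0,j}=u_0(j\Delta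 x)$, $u_{0,j}'=\frac1{\Delta x}\int_{I_j}u_0'\,dx$, $v_{0,j}=\frac1{\Delta x}\int_{I_j}v_0\,dx$. *)

theory Defs
  imports "HOL-Analysis.Analysis"
begin

definition L1_fun :: "(real \<Rightarrow> real) \<Rightarrow> bool" where
  "L1_fun f \<longleftrightarrow> integrable lebesgue f"

definition L2_fun :: "(real \<Rightarrow> real) \<Rightarrow> bool" where
  "L2_fun f \<longleftrightarrow> f \<in> borel_measurable lebesgue \<and> integrable lebesgue (\<lambda>x. (f x)\<^sup>2)"

definition test_function :: "(real \<Rightarrow> real) \<Rightarrow> bool" where
  "test_function \<phi> \<longleftrightarrow>
     (\<forall>n x. (deriv ^^ n) \<phi> differentiable (at x)) \<and>
     (\<exists>K. compact K \<and> (\<forall>x. x \<notin> K \<longrightarrow> \<phi> x = 0))"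

text \<open>\<open>has_H1_derivative u g\<close>: the class of \<open>u\<close> lies in \<open>H\<^sup>1(\<real>)\<close>, with weak derivative
  represented by \<open>g\<close>. Both \<open>u\<close> and \<open>g\<close> are representatives; the grid values of \<open>u\<close>
  make sense for its continuous representative.\<close>

definition has_H1_derivative :: "(real \<Rightarrow> real) \<Rightarrow> (real \<Rightarrow> real) \<Rightarrow> bool" where
  "has_H1_derivative u g \<longleftrightarrow>
     L2_fun u \<and> L2_fun g \<and>
     (\<forall>\<phi>. test_function \<phi> \<longrightarrow>
        (LINT x|lebesgue. u x * deriv \<phi> x) = - (LINT x|lebesgue. g x * \<phi> x))"

text \<open>Sequences on the grid are functions on \<open>int\<close>. A half-integer index \<open>j + 1/2\<close> is
  stored at \<open>j\<close>, and hence \<open>j - 1/2\<close> at \<open>j - 1\<close>.\<close>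

definition Dplus :: "real \<Rightarrow> (int \<Rightarrow> real) \<Rightarrow> int \<Rightarrow> real" where
  "Dplus dx K j = (K (j + 1) - K j) / dx"

definition Dminus :: "real \<Rightarrow> (int \<Rightarrow> real) \<Rightarrow> int \<Rightarrow> real" where
  "Dminus dx K j = - (K (j - 1) - K j) / dx"

definition cell :: "real \<Rightarrow> int \<Rightarrow> real set" where
  "cell dx j = {of_int j * dx - dx / 2 ..< of_int j * dx + dx / 2}"

definition cell_average :: "real \<Rightarrow> (real \<Rightarrow> real) \<Rightarrow> int \<Rightarrow> real" where
  "cell_average dx f j = (LINT x:cell dx j|lebesgue. f x) / dx"

definition F_fun :: "(real \<Rightarrow> real) \<Rightarrow> real \<Rightarrow> real" where
  "F_fun c u = (LBINT v=0..u. 2 * c v)"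

definition F_half :: "real \<Rightarrow> (int \<Rightarrow> real) \<Rightarrow> (int \<Rightarrow> real) \<Rightarrow> int \<Rightarrow> real" where
  "F_half dx R S j = dx * (\<Sum>\<^sub>\<infinity>i\<in>{..j}. R i - S i)"

definition u_half ::
  "(real \<Rightarrow> real) \<Rightarrow> real \<Rightarrow> (int \<Rightarrow> real) \<Rightarrow> (int \<Rightarrow> real) \<Rightarrow> int \<Rightarrow> real" where
  "u_half c dx R S j = inv (F_fun c) (F_half dx R S j)"

definition c_half ::
  "(real \<Rightarrow> real) \<Rightarrow> real \<Rightarrow> (int \<Rightarrow> real) \<Rightarrow> (int \<Rightarrow> real) \<Rightarrow> int \<Rightarrow> real" where
  "c_half c dx R S j = c (u_half c dx R S j)"

text \<open>An admissible choice of the mean value points: \<open>ubar\<close> for \<open>F\<close>, whose derivative is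
  \<open>2 * c\<close>, and \<open>up\<close> for \<open>c\<close>.\<close>

definition mean_value_points ::
  "(real \<Rightarrow> real) \<Rightarrow> real \<Rightarrow> (int \<Rightarrow> real) \<Rightarrow> (int \<Rightarrow> real) \<Rightarrow>
     (int \<Rightarrow> real) \<Rightarrow> (int \<Rightarrow> real) \<Rightarrow> bool" where
  "mean_value_points c dx R S ubar up \<longleftrightarrow>
     (\<forall>j. ubar j \<in> closed_segment (u_half c dx R S (j - 1)) (u_half c dx R S j) \<and>
          up j \<in> closed_segment (u_half c dx R S (j - 1)) (u_half c dx R S j) \<and>
          R j - S j = 2 * c (ubar j) * Dplus dx (u_half c dx R S) (j - 1) \<and>
          Dplus dx (c_half c dx R S) (j - 1) =
            deriv c (up j) * Dplus dx (u_half c dx R S) (j - 1))"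

definition c_tilde :: "(real \<Rightarrow> real) \<Rightarrow> (int \<Rightarrow> real) \<Rightarrow> (int \<Rightarrow> real) \<Rightarrow> int \<Rightarrow> real" where
  "c_tilde c ubar up j = deriv c (up j) / (4 * c (ubar j))"

definition l1_continuous :: "real \<Rightarrow> (real \<Rightarrow> int \<Rightarrow> real) \<Rightarrow> bool" where
  "l1_continuous T K \<longleftrightarrow>
     (\<forall>t\<in>{0..T}. (\<lambda>j. \<bar>K t j\<bar>) summable_on UNIV) \<and>
     (\<forall>t\<in>{0..T}. ((\<lambda>s. \<Sum>\<^sub>\<infinity>j. \<bar>K s j - K t j\<bar>) \<longlongrightarrow> 0) (at t within {0..T}))"

text \<open>Solutions on \<open>[0,T]\<close> are continuous curves in \<open>\<ell>\<^sup>1(\<int>)\<close> that satisfy the equations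
  coordinatewise. Under the standing assumptions on \<open>c\<close> the right-hand side is then
  continuous into \<open>\<ell>\<^sup>1(\<int>)\<close>, so this is the same as being a \<open>C\<^sup>1\<close> curve in \<open>\<ell>\<^sup>1(\<int>)\<close>
  solving the system. The mean value points may be chosen freely at each time; the
  choice does not affect the products \<open>c_tilde * (R\<^sup>2 - S\<^sup>2)\<close>.\<close>

definition scheme_solution ::
  "(real \<Rightarrow> real) \<Rightarrow> real \<Rightarrow> real \<Rightarrow> (real \<Rightarrow> int \<Rightarrow> real) \<Rightarrow> (real \<Rightarrow> int \<Rightarrow> real) \<Rightarrow>
     (real \<Rightarrow> int \<Rightarrow> real) \<Rightarrow> (real \<Rightarrow> int \<Rightarrow> real) \<Rightarrow> bool" where
  "scheme_solution c dx T R S ubar up \<longleftrightarrow>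
     l1_continuous T R \<and> l1_continuous T S \<and>
     (\<forall>t\<in>{0..T}. mean_value_points c dx (R t) (S t) (ubar t) (up t)) \<and>
     (\<forall>t\<in>{0..T}. \<forall>j.
        ((\<lambda>s. R s j) has_real_derivative
           c_half c dx (R t) (S t) j * Dplus dx (R t) j
             + c_tilde c (ubar t) (up t) j * ((R t j)\<^sup>2 - (S t j)\<^sup>2)) (at t within {0..T}) \<and>
        ((\<lambda>s. S s j) has_real_derivative
           - c_half c dx (R t) (S t) (j - 1) * Dminus dx (S t) j
             - c_tilde c (ubar t) (up t) j * ((R t j)\<^sup>2 - (S t j)\<^sup>2)) (at t within {0..T}))"

definition scheme_initial ::
  "(real \<Rightarrow> real) \<Rightarrow> real \<Rightarrow> (real \<Rightarrow> real) \<Rightarrow> (real \<Rightarrow> real) \<Rightarrow> (real \<Rightarrow> real) \<Rightarrow>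
     (real \<Rightarrow> int \<Rightarrow> real) \<Rightarrow> (real \<Rightarrow> int \<Rightarrow> real) \<Rightarrow> bool" where
  "scheme_initial c dx u0 du0 v0 R S \<longleftrightarrow>
     (\<forall>j. R 0 j = cell_average dx v0 j + c (u0 (of_int j * dx)) * cell_average dx du0 j \<and>
          S 0 j = cell_average dx v0 j - c (u0 (of_int j * dx)) * cell_average dx du0 j)"

end

theory Submission
  imports Defs
begin

text \<open>Both unknowns are transported by upwind differences, and \<open>D\<^sub>+ c\<^bsub>j-1/2\<^esub> = 2 c\<^sub>j (R\<^sub>j - S\<^sub>j)\<close>,
where \<open>c\<^sub>j\<close> stands for \<open>c_tilde\<close>. Hence every convex \<open>h\<close> obeys a discrete entropy
inequality: up to differences of fluxes, the time derivative of \<open>h(R\<^sub>j) + h(S\<^sub>j)\<close> is at most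
\<open>c\<^sub>j \<Pi>\<^sub>h(R\<^sub>j, S\<^sub>j)\<close> with
\<open>\<Pi>\<^sub>h(r,s) = (h'(r) - h'(s)) (r\<^sup>2 - s\<^sup>2) - 2 (r - s) (h(r) - h(s))\<close>
(\<open>weighted_entropy_inequality\<close>). Two choices of \<open>h\<close> matter.

For \<open>h(x) = x\<^sup>2\<close> the production \<open>\<Pi>\<^sub>h\<close> vanishes, which gives the energy bound
(\<open>energy_bound\<close>). For \<open>h(x) = x\<^sup>2 - (K + 1 - x) powr (1 + \<alpha>)\<close> and \<open>r, s \<le> K\<close> one finds
\<open>\<Pi>\<^sub>h(r,s) \<le> - (1 - \<alpha>) \<bar>r - s\<bar> powr (2 + \<alpha>)\<close> (\<open>shifted_entropy_production\<close>). The power alone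
is convex, so that its negative has the wrong convexity, and upwinding would
produce an error of the wrong sign; adding the square, which costs nothing in the
production, restores convexity because \<open>K + 1 - x \<ge> 1\<close>. Since
\<open>R\<^sub>j - S\<^sub>j\<close> is \<open>D\<^sub>+ u\<^bsub>j-1/2\<^esub>\<close> times a factor of at least \<open>2 C1\<close>, the production dominates the quantity to be
estimated. Summation against a trapezoidal weight that is \<open>1\<close> on the window and integration
in time bound its integral by the energy and the width of the window
(\<open>local_higher_integrability\<close>).

It remains to find an upper bound \<open>K\<close> of \<open>R\<close> and \<open>S\<close> that is uniform in the mesh size
(\<open>uniform_upper_bound\<close>). The discrete initial values need not inherit the sign of \<open>R\<^sub>0\<close> and
\<open>S\<^sub>0\<close>, because \<open>c(u\<^sub>0)\<close> is sampled at grid points while \<open>u\<^sub>0'\<close> is averaged over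
cells. However, \<open>u\<^sub>0\<close> oscillates on a cell by at most the integral of \<open>\<bar>u\<^sub>0'\<bar>\<close> over it, so by the
Cauchy-Schwarz inequality the positive part of an initial value is at most a multiple of the
integral of \<open>(u\<^sub>0')\<^sup>2\<close> over one cell, and this tends to \<open>0\<close> uniformly as the mesh
is refined. A comparison with a Riccati equation carries a small initial bound up to time \<open>T\<close>.
For coarser meshes the energy bounds each single value.

The oscillation estimate rests on the fact that the continuous representative of an
\<open>H\<^sup>1\<close> function is an integral of its weak derivative (\<open>H1_fundamental_theorem\<close>). The
integrand of the theorem is integrable in time because \<open>c'(u\<^sub>j\<^sup>+) \<bar>D\<^sub>+ u\<bar> = \<bar>D\<^sub>+ c\<bar>\<close>, whose right
side is continuous in time for every choice of the mean value points.\<close>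

section \<open>Smooth test functions\<close>

lemma smooth_if_in_deriv_closed_set:
  fixes f :: "real \<Rightarrow> real"
  assumes closed: "\<And>g. g \<in> F \<Longrightarrow> (\<forall>x. g differentiable (at x)) \<and> deriv g \<in> F"
    and "f \<in> F"
  shows "(deriv ^^ n) f differentiable (at x)"
proof -
  have "(deriv ^^ n) f \<in> F"
    by (induction n) (use assms in auto)
  then show ?thesis using closed by blast
qed

text \<open>The functions \<open>p / w ^ k * exp (- 1 / w)\<close> with \<open>w = x (1 - x)\<close> and a polynomial \<open>p\<close>, extended by \<open>0\<close>
outside the unit interval, form a class that is closed under differentiation. All of them
are therefore smooth, without a formula for the higher derivatives.\<close>

definition bump :: "real poly \<Rightarrow> nat \<Rightarrow> real \<Rightarrow> real" where
  "bump p k x = (if 0 < x \<and> x < 1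
     then poly p x / (x * (1 - x)) ^ k * exp (- 1 / (x * (1 - x))) else 0)"

lemma power_div_fact_le_exp:
  fixes x :: real
  assumes "x \<ge> 0"
  shows "x ^ n / fact n \<le> exp x"
proof -
  have "(\<Sum>i\<in>{n}. x ^ i /\<^sub>R fact i) \<le> (\<Sum>i. x ^ i /\<^sub>R fact i)"
    using assms by (intro sum_le_suminf summable_exp_generic) auto
  then show ?thesis by (simp add: exp_def divide_inverse mult.commute)
qed

text \<open>The exponential beats every power of \<open>w\<close>. Quadratic decay at \<open>0\<close> and at \<open>1\<close> is what
makes the derivative exist and vanish at the two points where the pieces are glued.\<close>

lemma bump_quadratic_bound:
  obtains B where "\<And>x. \<bar>bump p k x\<bar> \<le> B * x\<^sup>2" "\<And>x. \<bar>bump p k x\<bar> \<le> B * (1 - x)\<^sup>2"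
proof -
  obtain M where M: "\<And>x. x \<in> {0..1} \<Longrightarrow> norm (poly p x) \<le> M"
  proof -
    have "compact (poly p ` {0..1::real})"
      by (intro compact_continuous_image continuous_intros) auto
    then have "bounded (poly p ` {0..1})" by (rule compact_imp_bounded)
    then obtain M where "\<forall>y \<in> poly p ` {0..1}. norm y \<le> M" unfolding bounded_iff by blast
    then show ?thesis using that by blast
  qed
  have M0: "M \<ge> 0" using M[of 0] by (auto intro: order_trans[OF abs_ge_zero])
  define B where "B = M * fact (k + 2)"
  have B0: "B \<ge> 0" using M0 by (simp add: B_def)
  have main: "\<bar>bump p k x\<bar> \<le> B * (x * (1 - x))\<^sup>2" if x: "0 < x" "x < 1" for x
  proof -
    define w where "w = x * (1 - x)"
    have w: "w > 0" using x by (simp add: w_def)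
    \<comment> \<open>Two powers more than needed to cancel the denominator leave the factor \<open>w\<^sup>2\<close>.\<close>
    have "(1 / w) ^ (k + 2) / fact (k + 2) \<le> exp (1 / w)"
      using w by (intro power_div_fact_le_exp) simp
    moreover have "exp (- 1 / w) = 1 / exp (1 / w)"
      by (simp add: exp_minus divide_inverse)
    moreover have "(1 / w) ^ (k + 2) / fact (k + 2) = 1 / (fact (k + 2) * w ^ (k + 2))"
      by (simp add: power_one_over field_simps del: fact_Suc power_Suc)
    ultimately have "exp (- 1 / w) \<le> fact (k + 2) * w ^ (k + 2)"
      using w by (simp add: divide_le_eq le_divide_eq mult.commute del: fact_Suc power_Suc add_2_eq_Suc')
    then have "exp (- 1 / w) / w ^ k \<le> fact (k + 2) * w\<^sup>2"
      using w by (simp add: divide_le_eq power_add mult.assoc mult.commute mult.left_commute del: fact_Suc power_Suc add_2_eq_Suc')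
    then have "\<bar>poly p x\<bar> * (exp (- 1 / w) / w ^ k) \<le> M * (fact (k + 2) * w\<^sup>2)"
      using M[of x] x w M0 by (intro mult_mono) auto
    then show ?thesis
      using x w by (simp add: bump_def B_def abs_mult flip: w_def)
  qed
  have "\<bar>bump p k x\<bar> \<le> B * x\<^sup>2" "\<bar>bump p k x\<bar> \<le> B * (1 - x)\<^sup>2" for x
  proof -
    show "\<bar>bump p k x\<bar> \<le> B * x\<^sup>2"
    proof (cases "0 < x \<and> x < 1")
      case True
      then have "(x * (1 - x))\<^sup>2 \<le> x\<^sup>2" by (intro power_mono) (auto simp: mult_le_cancel_left1)
      then show ?thesis using main[of x] True B0 by (meson mult_left_mono order_trans)
    qed (use B0 in \<open>auto simp: bump_def\<close>)
    show "\<bar>bump p k x\<bar> \<le> B * (1 - x)\<^sup>2"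
    proof (cases "0 < x \<and> x < 1")
      case True
      then have "(x * (1 - x))\<^sup>2 \<le> (1 - x)\<^sup>2" by (intro power_mono) (auto simp: mult_le_cancel_right1)
      then show ?thesis using main[of x] True B0 by (meson mult_left_mono order_trans)
    qed (use B0 in \<open>auto simp: bump_def\<close>)
  qed
  then show ?thesis by (rule that)
qed

lemma DERIV_zero_if_quadratic_bound:
  fixes f :: "real \<Rightarrow> real"
  assumes "\<And>y. \<bar>f y\<bar> \<le> B * (y - x)\<^sup>2"
  shows "(f has_real_derivative 0) (at x)"
proof -
  have fx: "f x = 0" using assms[of x] by simp
  have "((\<lambda>h. f (x + h) / h) \<longlongrightarrow> 0) (at 0)"
  proof (rule Lim_null_comparison)
    show "\<forall>\<^sub>F h in at 0. norm (f (x + h) / h) \<le> B * \<bar>h\<bar>"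
    proof (intro always_eventually allI)
      fix h show "norm (f (x + h) / h) \<le> B * \<bar>h\<bar>"
        using assms[of "x + h"] by (cases "h = 0") (auto simp: field_simps power2_eq_square abs_mult_self_eq)
    qed
    show "((\<lambda>h. B * \<bar>h\<bar>) \<longlongrightarrow> 0) (at 0)" by (auto intro!: tendsto_eq_intros)
  qed
  then show ?thesis by (simp add: DERIV_def fx)
qed

definition bump_deriv_poly :: "real poly \<Rightarrow> nat \<Rightarrow> real poly" where
  "bump_deriv_poly p k = pderiv p * [:0, 1, -1:]\<^sup>2
     + p * [:1, -2:] * ([:1:] - smult (of_nat k) [:0, 1, -1:])"

lemma DERIV_bump:
  "(bump p k has_real_derivative bump (bump_deriv_poly p k) (k + 2) x) (at x)"
proof -
  obtain B where B: "\<And>x. \<bar>bump p k x\<bar> \<le> B * x\<^sup>2" "\<And>x. \<bar>bump p k x\<bar> \<le> B * (1 - x)\<^sup>2"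
    using bump_quadratic_bound[of p k] by blast
  consider "x < 0 \<or> x > 1" | "x = 0" | "x = 1" | "0 < x \<and> x < 1" by linarith
  then show ?thesis
  proof cases
    case 1
    have "((\<lambda>x. 0) has_real_derivative 0) (at x)" by simp
    moreover have "\<forall>\<^sub>F y in nhds x. bump p k y = 0"
    proof -
      have "open ({..<0} \<union> {1<..} :: real set)" by auto
      then have "\<forall>\<^sub>F y in nhds x. y \<in> ({..<0} \<union> {1<..} :: real set)"
        using 1 by (intro eventually_nhds_in_open) auto
      then show ?thesis by eventually_elim (auto simp: bump_def)
    qed
    ultimately have "(bump p k has_real_derivative 0) (at x)"
      by (subst DERIV_cong_ev[OF refl _ refl]) auto
    then show ?thesis using 1 by (auto simp: bump_def)
  next
    case 2
    then show ?thesis using DERIV_zero_if_quadratic_bound[of "bump p k" B 0] B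
      by (simp add: bump_def)
  next
    case 3
    then show ?thesis using DERIV_zero_if_quadratic_bound[of "bump p k" B 1] B
      by (simp add: bump_def power2_commute)
  next
    case 4
    define w where "w = x * (1 - x)"
    have w: "w > 0" using 4 by (simp add: w_def)
    have "((\<lambda>x. poly p x / (x * (1 - x)) ^ k * exp (- 1 / (x * (1 - x)))) has_real_derivative
       bump (bump_deriv_poly p k) (k + 2) x) (at x)"
    proof -
      have W: "((\<lambda>y. y * (1 - y)) has_real_derivative 1 - 2 * x) (at x)"
        by (auto intro!: derivative_eq_intros)
      have P: "((\<lambda>y. inverse ((y * (1 - y)) ^ k)) has_real_derivative
          - of_nat k * (1 - 2 * x) / w ^ (k + 1)) (at x)"
      proof (cases k)
        case (Suc m)
        show ?thesis
          by (rule DERIV_cong, rule DERIV_inverse_fun[OF DERIV_power[OF W]])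
            (use w in \<open>simp_all add: Suc field_simps flip: w_def\<close>)
      qed simp
      have "((\<lambda>y. - 1 / (y * (1 - y))) has_real_derivative (1 - 2 * x) / w\<^sup>2) (at x)"
        using DERIV_minus[OF DERIV_inverse_fun[OF W]] w
        by (simp add: divide_inverse power2_eq_square mult_ac flip: w_def)
      from DERIV_fun_exp[OF this]
      have E: "((\<lambda>y. exp (- 1 / (y * (1 - y)))) has_real_derivative
          exp (- 1 / w) * ((1 - 2 * x) / w\<^sup>2)) (at x)"
        by (simp only: w_def[symmetric])
      have "((\<lambda>y. poly p y * inverse ((y * (1 - y)) ^ k) * exp (- 1 / (y * (1 - y)))) has_real_derivative
          (poly (pderiv p) x * inverse (w ^ k) + (- of_nat k * (1 - 2 * x) / w ^ (k + 1)) * poly p x)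
            * exp (- 1 / w) + exp (- 1 / w) * ((1 - 2 * x) / w\<^sup>2) * (poly p x * inverse (w ^ k))) (at x)"
        using DERIV_mult[OF DERIV_mult[OF poly_DERIV P] E] by (simp only: w_def[symmetric])
      moreover have "(A * inverse v + (- K * D / (w * v)) * Q) * e + e * (D / w\<^sup>2) * (Q * inverse v)
          = (A * w\<^sup>2 + Q * D * (1 - K * w)) / (w\<^sup>2 * v) * e"
        if "v \<noteq> 0" for A v K D Q e :: real
        using w that by (simp add: field_simps power2_eq_square)
      from this[of "w ^ k"]
      have "(poly (pderiv p) x * inverse (w ^ k) + (- of_nat k * (1 - 2 * x) / w ^ (k + 1)) * poly p x)
            * exp (- 1 / w) + exp (- 1 / w) * ((1 - 2 * x) / w\<^sup>2) * (poly p x * inverse (w ^ k))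
          = (poly (pderiv p) x * w\<^sup>2 + poly p x * (1 - 2 * x) * (1 - of_nat k * w)) / w ^ (k + 2) * exp (- 1 / w)"
        using w by (simp add: power2_eq_square mult.assoc)
      moreover have "poly (bump_deriv_poly p k) x
          = poly (pderiv p) x * w\<^sup>2 + poly p x * (1 - 2 * x) * (1 - of_nat k * w)"
        by (simp add: bump_deriv_poly_def w_def algebra_simps)
      ultimately show ?thesis
        using 4 by (simp add: bump_def divide_inverse flip: w_def)
    qed
    moreover have "\<forall>\<^sub>F y in nhds x. bump p k y = poly p y / (y * (1 - y)) ^ k * exp (- 1 / (y * (1 - y)))"
    proof -
      have "\<forall>\<^sub>F y in nhds x. y \<in> {0<..<1}"
        using 4 by (intro eventually_nhds_in_open) auto
      then show ?thesis by eventually_elim (auto simp: bump_def)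
    qed
    ultimately show ?thesis
      by (subst DERIV_cong_ev[OF refl _ refl]) auto
  qed
qed


lemma smooth_bump: "(deriv ^^ n) (bump p k) differentiable (at x)"
proof (rule smooth_if_in_deriv_closed_set[where F = "{bump p k |p k. True}"])
  fix g assume "g \<in> {bump p k |p k. True}"
  then obtain p k where g: "g = bump p k" by blast
  have "deriv g = bump (bump_deriv_poly p k) (k + 2)"
    unfolding g by (intro ext DERIV_imp_deriv DERIV_bump)
  then show "(\<forall>x. g differentiable (at x)) \<and> deriv g \<in> {bump p k |p k. True}"
    using DERIV_bump real_differentiable_def g by blast
qed blast

definition unit_bump :: "real \<Rightarrow> real" where "unit_bump = bump 1 0"

lemma unit_bump_nonneg: "unit_bump x \<ge> 0"
  and unit_bump_eq_0: "x \<le> 0 \<or> 1 \<le> x \<Longrightarrow> unit_bump x = 0"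
  and unit_bump_pos: "0 < x \<Longrightarrow> x < 1 \<Longrightarrow> 0 < unit_bump x"
  by (auto simp: unit_bump_def bump_def)

lemma continuous_on_unit_bump: "continuous_on A unit_bump"
  unfolding unit_bump_def
  using DERIV_bump by (meson DERIV_isCont continuous_at_imp_continuous_on)

text \<open>Any lower limit to the left of the support would do; a negative one makes the derivative at
\<open>0\<close> two-sided.\<close>

definition smooth_step :: "real \<Rightarrow> real" where
  "smooth_step x = integral {-1..x} unit_bump"

lemma smooth_step_eq_0: "x \<le> 0 \<Longrightarrow> smooth_step x = 0"
  unfolding smooth_step_def
  by (subst integral_cong[where g = "\<lambda>_. 0"]) (auto simp: unit_bump_eq_0)

lemma unit_bump_integrable_on: "unit_bump integrable_on {a..b}"
  by (intro integrable_continuous_interval continuous_on_unit_bump)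

lemma DERIV_smooth_step: "(smooth_step has_real_derivative unit_bump x) (at x)"
proof (cases "x < 0")
  case True
  have "\<forall>\<^sub>F y in nhds x. y \<in> {..<0}" using True by (intro eventually_nhds_in_open) auto
  then have "\<forall>\<^sub>F y in nhds x. smooth_step y = 0"
    by eventually_elim (simp add: smooth_step_eq_0)
  then have "(smooth_step has_real_derivative 0) (at x)"
    by (subst DERIV_cong_ev[OF refl _ refl]) auto
  then show ?thesis using True by (simp add: unit_bump_eq_0)
next
  case False
  have "((\<lambda>u. integral {-1..u} unit_bump) has_real_derivative unit_bump x) (at x within {-1..x + 1})"
    using False by (intro integral_has_real_derivative continuous_on_unit_bump) auto
  moreover have "at x within {-1..x + 1} = at x"
    using False by (intro at_within_interior) (auto simp: interior_atLeastAtMost_real)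
  ultimately show ?thesis by (simp add: smooth_step_def[abs_def])
qed

lemma continuous_on_smooth_step: "continuous_on A smooth_step"
  by (intro continuous_at_imp_continuous_on ballI DERIV_isCont[OF DERIV_smooth_step])

lemma deriv_smooth_step: "deriv smooth_step = unit_bump"
  by (intro ext DERIV_imp_deriv DERIV_smooth_step)

lemma smooth_step_ge_1:
  assumes "1 \<le> x"
  shows "smooth_step x = smooth_step 1"
proof -
  have "integral {-1..1} unit_bump + integral {1..x} unit_bump = integral {-1..x} unit_bump"
    using assms by (intro Henstock_Kurzweil_Integration.integral_combine unit_bump_integrable_on) auto
  moreover have "integral {1..x} unit_bump = integral {1..x} (\<lambda>_. 0)"
    by (rule integral_cong) (auto simp: unit_bump_eq_0)
  ultimately show ?thesis by (simp add: smooth_step_def)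
qed

lemma smooth_smooth_step: "(deriv ^^ n) smooth_step differentiable (at x)"
proof (cases n)
  case 0
  then show ?thesis using DERIV_smooth_step real_differentiable_def by auto
next
  case (Suc m)
  then have "(deriv ^^ n) smooth_step = (deriv ^^ m) unit_bump"
    by (simp add: funpow_Suc_right deriv_smooth_step del: funpow.simps)
  then show ?thesis by (simp add: unit_bump_def smooth_bump)
qed

lemma mono_smooth_step: "x \<le> y \<Longrightarrow> smooth_step x \<le> smooth_step y"
  by (rule DERIV_nonneg_imp_nondecreasing) (use DERIV_smooth_step unit_bump_nonneg in blast)+

lemma smooth_step_1_pos: "smooth_step 1 > 0"
proof -
  have "smooth_step 0 < smooth_step 1"
    by (rule DERIV_pos_imp_increasing_open[OF _ _ continuous_on_smooth_step])
      (simp, use DERIV_smooth_step unit_bump_pos in blast)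
  then show ?thesis by (simp add: smooth_step_eq_0)
qed

lemma deriv_funpow_affine:
  fixes f :: "real \<Rightarrow> real"
  assumes "\<And>n x. (deriv ^^ n) f differentiable (at x)"
  shows "(deriv ^^ n) (\<lambda>x. f ((x - a) / e)) = (\<lambda>x. (deriv ^^ n) f ((x - a) / e) / e ^ n)"
proof (induction n)
  case (Suc n)
  have "deriv (\<lambda>x. (deriv ^^ n) f ((x - a) / e) / e ^ n) x = (deriv ^^ Suc n) f ((x - a) / e) / e ^ Suc n" for x
  proof (rule DERIV_imp_deriv)
    have "((deriv ^^ n) f has_real_derivative (deriv ^^ Suc n) f ((x - a) / e)) (at ((x - a) / e))"
      using assms[of n "(x - a) / e"] DERIV_deriv_iff_real_differentiable by auto
    moreover have "((\<lambda>x. (x - a) / e) has_real_derivative 1 / e) (at x)"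
      by (auto intro!: derivative_eq_intros simp: divide_inverse)
    ultimately have "((\<lambda>x. (deriv ^^ n) f ((x - a) / e)) has_real_derivative
       (deriv ^^ Suc n) f ((x - a) / e) * (1 / e)) (at x)"
      by (rule DERIV_chain2)
    from DERIV_cdivide[OF this, of "e ^ n"]
    show "((\<lambda>x. (deriv ^^ n) f ((x - a) / e) / e ^ n) has_real_derivative
       (deriv ^^ Suc n) f ((x - a) / e) / e ^ Suc n) (at x)"
      by (simp add: field_simps)
  qed
  then show ?case using Suc by auto
qed auto

lemma smooth_affine:
  fixes f :: "real \<Rightarrow> real"
  assumes "\<And>n x. (deriv ^^ n) f differentiable (at x)"
  shows "(deriv ^^ n) (\<lambda>x. f ((x - a) / e)) differentiable (at x)"
proof -
  have "(deriv ^^ n) f differentiable (at ((x - a) / e))" by fact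
  moreover have "(\<lambda>x. (x - a) / e) differentiable (at x)"
    by (cases "e = 0") (auto intro!: derivative_intros)
  ultimately have "(\<lambda>x. (deriv ^^ n) f ((x - a) / e)) differentiable (at x)"
    using differentiable_chain_at[of "\<lambda>x. (x - a) / e" x "(deriv ^^ n) f"] by (simp add: o_def)
  then have "(\<lambda>x. (1 / e ^ n) * (deriv ^^ n) f ((x - a) / e)) differentiable (at x)"
    by (intro derivative_intros) auto
  then show ?thesis by (simp add: deriv_funpow_affine[OF assms])
qed

lemma smooth_diff:
  fixes f g :: "real \<Rightarrow> real"
  assumes "\<And>n x. (deriv ^^ n) f differentiable (at x)" "\<And>n x. (deriv ^^ n) g differentiable (at x)"
  shows "(deriv ^^ n) (\<lambda>x. f x - g x) differentiable (at x)"
proof -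
  have "(deriv ^^ n) (\<lambda>x. f x - g x) = (\<lambda>x. (deriv ^^ n) f x - (deriv ^^ n) g x)" for n
  proof (induction n)
    case (Suc n)
    have "deriv (\<lambda>x. (deriv ^^ n) f x - (deriv ^^ n) g x) x = (deriv ^^ Suc n) f x - (deriv ^^ Suc n) g x" for x
      using assms[of n x] DERIV_deriv_iff_real_differentiable
      by (intro DERIV_imp_deriv) (auto intro!: derivative_eq_intros)
    then show ?case using Suc by auto
  qed auto
  then show ?thesis using assms by auto
qed

section \<open>Fundamental theorem of calculus for weak derivatives\<close>

lemma integrable_lebesgue_continuous_support:
  fixes f :: "real \<Rightarrow> real"
  assumes "continuous_on UNIV f" "\<And>x. x \<notin> {a..b} \<Longrightarrow> f x = 0"
  shows "integrable lebesgue f"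
proof -
  have "set_integrable lborel {a..b} f"
    by (rule borel_integrable_atLeastAtMost') (rule continuous_on_subset[OF assms(1)], simp)
  moreover have "(\<lambda>x. indicat_real {a..b} x *\<^sub>R f x) = f"
  proof
    fix x show "indicat_real {a..b} x *\<^sub>R f x = f x"
      using assms(2)[of x] by (cases "x \<in> {a..b}") auto
  qed
  ultimately have "integrable lborel f" by (simp add: set_integrable_def)
  then show ?thesis by (subst integrable_completion) auto
qed

lemma integral_unit_bump: "(LINT x|lebesgue. unit_bump x) = smooth_step 1"
proof -
  have "set_integrable lborel {-1..1} unit_bump"
    by (rule borel_integrable_atLeastAtMost') (rule continuous_on_unit_bump)
  then have "(LINT x:{-1..1}|lborel. unit_bump x) = smooth_step 1"
    unfolding smooth_step_def by (rule set_borel_integral_eq_integral)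
  moreover have "(\<lambda>x. indicat_real {-1..1} x *\<^sub>R unit_bump x) = unit_bump"
  proof
    fix x show "indicat_real {-1..1} x *\<^sub>R unit_bump x = unit_bump x"
      using unit_bump_eq_0[of x] by (cases "x \<in> {-1..1}") auto
  qed
  ultimately have "(LINT x|lborel. unit_bump x) = smooth_step 1"
    by (simp add: set_lebesgue_integral_def)
  moreover have "unit_bump \<in> borel_measurable lborel"
    using continuous_on_unit_bump[of UNIV] by (simp add: borel_measurable_continuous_onI)
  ultimately show ?thesis by (simp add: integral_completion)
qed

lemma L2_set_integrable:
  assumes "L2_fun f" "A \<in> sets lebesgue" "emeasure lebesgue A < \<infinity>"
  shows "set_integrable lebesgue A f" "set_integrable lebesgue A (\<lambda>x. (f x)\<^sup>2)"
    "set_integrable lebesgue A (\<lambda>x. \<bar>f x\<bar>)"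
proof -
  have f: "f \<in> borel_measurable lebesgue" "integrable lebesgue (\<lambda>x. (f x)\<^sup>2)"
    using assms(1) by (auto simp: L2_fun_def)
  show sq: "set_integrable lebesgue A (\<lambda>x. (f x)\<^sup>2)"
    unfolding set_integrable_def using f(2) assms(2) by (rule integrable_mult_indicator[rotated])
  have one: "set_integrable lebesgue A (\<lambda>x. 1 :: real)"
    unfolding set_integrable_def using assms(2,3) by simp
  have "set_integrable lebesgue A (\<lambda>x. 1 + (f x)\<^sup>2)"
    using one sq by (rule set_integral_add)
  then have "integrable lebesgue (\<lambda>x. indicat_real A x *\<^sub>R f x)"
    unfolding set_integrable_def
  proof (rule Bochner_Integration.integrable_bound)
    show "(\<lambda>x. indicat_real A x *\<^sub>R f x) \<in> borel_measurable lebesgue"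
      using f assms by measurable
    have "\<bar>f x\<bar> \<le> 1 + (f x)\<^sup>2" for x
      using sum_squares_bound[of "\<bar>f x\<bar>" 1] by (auto simp: power2_eq_square)
    then show "AE x in lebesgue. norm (indicat_real A x *\<^sub>R f x) \<le> norm (indicat_real A x *\<^sub>R (1 + (f x)\<^sup>2))"
      by (intro always_eventually allI) (auto simp: indicator_def)
  qed
  then show "set_integrable lebesgue A f" by (simp add: set_integrable_def)
  then show "set_integrable lebesgue A (\<lambda>x. \<bar>f x\<bar>)" by (rule set_integrable_abs)
qed

text \<open>This difference of two steps approximates, as \<open>e\<close> tends to \<open>0\<close>, a multiple of the indicator
  function of \<open>{x<..y}\<close>.\<close>

lemma test_function_smoothed_interval:
  assumes "0 < e"
  shows "test_function (\<lambda>z. smooth_step ((z - x) / e) - smooth_step ((z - y) / e))"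
    (is "test_function ?\<phi>")
proof -
  have "?\<phi> z = 0" if "z \<notin> {min x y..max x y + e}" for z
  proof -
    consider "z < min x y" | "z > max x y + e" using \<open>z \<notin> _\<close> by force
    then show ?thesis
    proof cases
      case 1
      then show ?thesis using assms by (simp add: smooth_step_eq_0 divide_le_0_iff)
    next
      case 2
      then have "1 \<le> (z - x) / e" "1 \<le> (z - y) / e" using assms by (auto simp: le_divide_eq)
      then show ?thesis using smooth_step_ge_1[of "(z - x) / e"] smooth_step_ge_1[of "(z - y) / e"] by simp
    qed
  qed
  moreover have "(deriv ^^ n) ?\<phi> differentiable (at z)" for n z
    by (intro smooth_diff smooth_affine smooth_smooth_step)
  moreover have "compact {min x y..max x y + e}" by simp
  ultimately show ?thesis unfolding test_function_def by blast
qed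

lemma deriv_smoothed_interval:
  assumes "0 < e"
  shows "deriv (\<lambda>z. smooth_step ((z - x) / e) - smooth_step ((z - y) / e)) z
     = unit_bump ((z - x) / e) / e - unit_bump ((z - y) / e) / e"
proof (rule DERIV_imp_deriv)
  have *: "((\<lambda>z. smooth_step ((z - x) / e)) has_real_derivative unit_bump ((z - x) / e) / e) (at z)" for x
  proof -
    have "((\<lambda>x'. (x' - x) / e) has_real_derivative 1 / e) (at z)"
      using assms by (auto intro!: derivative_eq_intros)
    from DERIV_chain2[OF DERIV_smooth_step this] show ?thesis by simp
  qed
  show "((\<lambda>z. smooth_step ((z - x) / e) - smooth_step ((z - y) / e)) has_real_derivative
     unit_bump ((z - x) / e) / e - unit_bump ((z - y) / e) / e) (at z)"
    by (intro DERIV_diff *)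
qed

text \<open>The derivative of the smoothed indicator consists of two bumps that concentrate at the
endpoints. Scaling turns each integral into an average of \<open>u\<close> near one endpoint.\<close>

lemma mollified_value:
  fixes u :: "real \<Rightarrow> real"
  assumes u: "continuous_on UNIV u"
  shows "integrable lebesgue (\<lambda>z. u z * (unit_bump ((z - x) / inverse (real (Suc n))) / inverse (real (Suc n))))"
    and "(\<lambda>n. LINT z|lebesgue. u z * (unit_bump ((z - x) / inverse (real (Suc n))) / inverse (real (Suc n))))
       \<longlonglongrightarrow> u x * smooth_step 1"
proof -
  define e where "e n = inverse (real (Suc n))" for n
  have e: "e n > 0" "e n \<le> 1" for n by (auto simp: e_def inverse_le_1_iff)
  have cont: "continuous_on UNIV (\<lambda>w. u (x + e n * w) * unit_bump w)" for n
    by (intro continuous_intros continuous_on_unit_bump continuous_on_compose2[OF u]) auto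
  have int': "integrable lebesgue (\<lambda>w. u (x + e n * w) * unit_bump w)" for n
    by (rule integrable_lebesgue_continuous_support[OF cont, of 0 1]) (auto simp: unit_bump_eq_0)
  have eq: "(\<lambda>w. u (x + e n * w) * (unit_bump ((x + e n * w - x) / e n) / e n))
      = (\<lambda>w. (1 / e n) * (u (x + e n * w) * unit_bump w))" for n
    using e(1)[of n] by (auto simp: field_simps)
  have int: "integrable lebesgue (\<lambda>z. u z * (unit_bump ((z - x) / e n) / e n))" for n
    using lebesgue_integrable_real_affine_iff[of "e n" "\<lambda>z. u z * (unit_bump ((z - x) / e n) / e n)" x]
      int'[of n] e(1)[of n] unfolding eq by simp
  then show "integrable lebesgue (\<lambda>z. u z * (unit_bump ((z - x) / inverse (real (Suc n))) / inverse (real (Suc n))))"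
    by (simp only: e_def)
  have val: "(LINT z|lebesgue. u z * (unit_bump ((z - x) / e n) / e n)) = (LINT w|lebesgue. u (x + e n * w) * unit_bump w)" for n
    using lebesgue_integral_real_affine[of "e n" "\<lambda>z. u z * (unit_bump ((z - x) / e n) / e n)" x] e(1)[of n]
    unfolding eq by simp
  have "compact (u ` {x..x + 1})"
    by (intro compact_continuous_image continuous_on_subset[OF u]) auto
  then have "bounded (u ` {x..x + 1})" by (rule compact_imp_bounded)
  then obtain M where "\<forall>v \<in> u ` {x..x + 1}. norm v \<le> M" unfolding bounded_iff by blast
  then have M: "\<bar>u z\<bar> \<le> M" if "z \<in> {x..x + 1}" for z using that by auto
  have "(\<lambda>n. LINT w|lebesgue. u (x + e n * w) * unit_bump w) \<longlonglongrightarrow> (LINT w|lebesgue. u x * unit_bump w)"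
  proof (rule integral_dominated_convergence)
    show "(\<lambda>w. u x * unit_bump w) \<in> borel_measurable lebesgue"
      by (intro borel_measurable_integrable integrable_lebesgue_continuous_support[of _ 0 1] continuous_intros continuous_on_unit_bump)
        (auto simp: unit_bump_eq_0)
    show "(\<lambda>w. u (x + e n * w) * unit_bump w) \<in> borel_measurable lebesgue" for n
      using int' by (rule borel_measurable_integrable)
    show "integrable lebesgue (\<lambda>w. M * unit_bump w)"
      by (intro integrable_lebesgue_continuous_support[of _ 0 1] continuous_intros continuous_on_unit_bump)
        (auto simp: unit_bump_eq_0)
    have "e \<longlonglongrightarrow> 0" unfolding e_def by (rule LIMSEQ_inverse_real_of_nat)
    then have "(\<lambda>n. x + e n * w) \<longlonglongrightarrow> x" for w by (auto intro!: tendsto_eq_intros)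
    then have "(\<lambda>n. u (x + e n * w)) \<longlonglongrightarrow> u x" for w
      by (rule continuous_on_tendsto_compose[OF u]) auto
    then show "AE w in lebesgue. (\<lambda>n. u (x + e n * w) * unit_bump w) \<longlonglongrightarrow> u x * unit_bump w"
      by (intro always_eventually allI tendsto_intros)
    have "\<bar>u (x + e n * w) * unit_bump w\<bar> \<le> M * unit_bump w" for n w
    proof (cases "0 < w \<and> w < 1")
      case True
      have "0 \<le> e n * w" "e n * w \<le> 1 * 1"
        using True e[of n] by (simp, intro mult_mono) auto
      then have "\<bar>u (x + e n * w)\<bar> \<le> M" by (intro M) auto
      then show ?thesis using unit_bump_nonneg[of w] by (auto simp: abs_mult intro: mult_right_mono)
    next
      case False
      then have "unit_bump w = 0" by (intro unit_bump_eq_0) linarith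
      then show ?thesis by simp
    qed
    then show "AE w in lebesgue. norm (u (x + e n * w) * unit_bump w) \<le> M * unit_bump w" for n
      by (intro always_eventually allI) simp
  qed
  then show "(\<lambda>n. LINT z|lebesgue. u z * (unit_bump ((z - x) / inverse (real (Suc n))) / inverse (real (Suc n))))
       \<longlonglongrightarrow> u x * smooth_step 1"
    using val by (simp add: integral_unit_bump e_def[symmetric] del: of_nat_Suc)
qed

text \<open>Testing the weak derivative against the smoothed indicators gives \<open>u x - u y\<close> on one side and
minus the integral over \<open>{x<..y}\<close> on the other, both multiplied by the mass of the bump.\<close>

lemma H1_fundamental_theorem:
  assumes H: "has_H1_derivative u g" and u: "continuous_on UNIV u" and "x < y"
  shows "u y - u x = (LINT z:{x<..y}|lebesgue. g z)"
proof -
  define e where "e n = inverse (real (Suc n))" for n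
  have e: "e n > 0" "e n \<le> 1" for n by (auto simp: e_def inverse_le_1_iff)
  have e0: "e \<longlonglongrightarrow> 0" unfolding e_def by (rule LIMSEQ_inverse_real_of_nat)
  define \<phi> where "\<phi> n z = smooth_step ((z - x) / e n) - smooth_step ((z - y) / e n)" for n z
  have g: "L2_fun g" using H by (simp add: has_H1_derivative_def)
  have gm: "g \<in> borel_measurable lebesgue" using g by (simp add: L2_fun_def)
  have "(LINT z|lebesgue. u z * deriv (\<phi> n) z) = - (LINT z|lebesgue. g z * \<phi> n z)" for n
    using H test_function_smoothed_interval[OF e(1)[of n], of x y]
    unfolding has_H1_derivative_def \<phi>_def by blast
  moreover have "(LINT z|lebesgue. u z * deriv (\<phi> n) z)
      = (LINT z|lebesgue. u z * (unit_bump ((z - x) / e n) / e n)) - (LINT z|lebesgue. u z * (unit_bump ((z - y) / e n) / e n))" for n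
    unfolding \<phi>_def deriv_smoothed_interval[OF e(1)] right_diff_distrib
    by (intro Bochner_Integration.integral_diff mollified_value(1)[OF u, folded e_def])
  ultimately have "(\<lambda>n. - (LINT z|lebesgue. g z * \<phi> n z)) \<longlonglongrightarrow> u x * smooth_step 1 - u y * smooth_step 1"
    using tendsto_diff[OF mollified_value(2)[OF u, where x = x, folded e_def] mollified_value(2)[OF u, where x = y, folded e_def]] by simp
  moreover have "(\<lambda>n. LINT z|lebesgue. g z * \<phi> n z) \<longlonglongrightarrow> (LINT z|lebesgue. smooth_step 1 * (indicat_real {x<..y} z * g z))"
  proof (rule integral_dominated_convergence)
    show "(\<lambda>z. smooth_step 1 * (indicat_real {x<..y} z * g z)) \<in> borel_measurable lebesgue"
      by (intro borel_measurable_times borel_measurable_const borel_measurable_indicator gm) simp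
    have "continuous_on UNIV (\<lambda>z. smooth_step ((z - a) / e n))" for a n
      by (rule continuous_on_compose2[OF continuous_on_smooth_step[of UNIV]])
        (use e(1)[of n] in \<open>auto intro!: continuous_intros\<close>)
    then have "continuous_on UNIV (\<phi> n)" for n
      unfolding \<phi>_def by (intro continuous_on_diff)
    then have "\<phi> n \<in> borel_measurable lborel" for n by (simp add: borel_measurable_continuous_onI)
    then have "\<phi> n \<in> borel_measurable lebesgue" for n by (rule measurable_completion)
    then show "(\<lambda>z. g z * \<phi> n z) \<in> borel_measurable lebesgue" for n using gm by measurable
    show "integrable lebesgue (\<lambda>z. smooth_step 1 * (indicat_real {x..y + 1} z *\<^sub>R \<bar>g z\<bar>))"
      using L2_set_integrable(3)[OF g, of "{x..y + 1}"] by (simp add: set_integrable_def emeasure_lborel_Icc_eq)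
    have lim: "(\<lambda>n. smooth_step ((z - a) / e n)) \<longlonglongrightarrow> (if a < z then smooth_step 1 else 0)" for a z
    proof (cases "a < z")
      case True
      then have "\<forall>\<^sub>F n in sequentially. e n < z - a"
        using e0 by (auto intro: order_tendstoD)
      then have "\<forall>\<^sub>F n in sequentially. smooth_step ((z - a) / e n) = smooth_step 1"
        by eventually_elim (use e(1) in \<open>auto intro!: smooth_step_ge_1 simp: le_divide_eq\<close>)
      then show ?thesis using True by (auto intro: tendsto_eventually)
    next
      case False
      then have "smooth_step ((z - a) / e n) = 0" for n
        using e(1)[of n] by (intro smooth_step_eq_0) (simp add: divide_le_0_iff)
      then show ?thesis using False by simp
    qed
    have "(\<lambda>n. g z * \<phi> n z) \<longlonglongrightarrow> g z * ((if x < z then smooth_step 1 else 0) - (if y < z then smooth_step 1 else 0))" for z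
      unfolding \<phi>_def by (intro tendsto_intros lim)
    moreover have "g z * ((if x < z then smooth_step 1 else 0) - (if y < z then smooth_step 1 else 0))
        = smooth_step 1 * (indicat_real {x<..y} z * g z)" for z
      using \<open>x < y\<close> by (auto simp: indicator_def)
    ultimately show "AE z in lebesgue. (\<lambda>n. g z * \<phi> n z) \<longlonglongrightarrow> smooth_step 1 * (indicat_real {x<..y} z * g z)"
      by (intro always_eventually allI) simp
    have range: "0 \<le> smooth_step w" "smooth_step w \<le> smooth_step 1" for w
    proof -
      show "0 \<le> smooth_step w"
        using mono_smooth_step[of 0 w] by (cases "w \<le> 0") (auto simp: smooth_step_eq_0)
      show "smooth_step w \<le> smooth_step 1"
        using mono_smooth_step[of w 1] smooth_step_ge_1[of w] by (cases "w \<le> 1") auto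
    qed
    have "\<bar>\<phi> n z\<bar> \<le> smooth_step 1 * indicat_real {x..y + 1} z" for n z
    proof (cases "z \<in> {x..y + 1}")
      case True
      then show ?thesis
        using range[of "(z - x) / e n"] range[of "(z - y) / e n"] unfolding \<phi>_def by auto
    next
      case False
      have "\<phi> n z = 0"
      proof (cases "z < x")
        case True
        then show ?thesis using e(1)[of n] \<open>x < y\<close>
          by (simp add: \<phi>_def smooth_step_eq_0 divide_le_0_iff)
      next
        case False
        then have "z > y + 1" using \<open>z \<notin> _\<close> by auto
        then have "1 \<le> (z - x) / e n" "1 \<le> (z - y) / e n"
          using \<open>x < y\<close> e[of n] by (auto simp: le_divide_eq)
        then show ?thesis
          using smooth_step_ge_1[of "(z - x) / e n"] smooth_step_ge_1[of "(z - y) / e n"] by (simp add: \<phi>_def)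
      qed
      then show ?thesis using smooth_step_1_pos by simp
    qed
    then have "norm (g z * \<phi> n z) \<le> smooth_step 1 * (indicat_real {x..y + 1} z *\<^sub>R \<bar>g z\<bar>)" for n z
      using mult_left_mono[OF _ abs_ge_zero[of "g z"]] by (fastforce simp: abs_mult mult_ac)
    then show "AE z in lebesgue. norm (g z * \<phi> n z) \<le> smooth_step 1 * (indicat_real {x..y + 1} z *\<^sub>R \<bar>g z\<bar>)" for n
      by (intro always_eventually allI)
  qed
  from tendsto_minus[OF this]
  have "(\<lambda>n. - (LINT z|lebesgue. g z * \<phi> n z)) \<longlonglongrightarrow> - (smooth_step 1 * (LINT z:{x<..y}|lebesgue. g z))"
    by (simp add: set_lebesgue_integral_def)
  ultimately have "u x * smooth_step 1 - u y * smooth_step 1 = - (smooth_step 1 * (LINT z:{x<..y}|lebesgue. g z))"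
    by (rule LIMSEQ_unique)
  then have "smooth_step 1 * (u y - u x) = smooth_step 1 * (LINT z:{x<..y}|lebesgue. g z)"
    by (simp add: algebra_simps)
  then show ?thesis using smooth_step_1_pos by simp
qed

section \<open>Discrete initial values\<close>

lemma cell_measurable: "cell dx j \<in> sets lebesgue"
  by (simp add: cell_def)

lemma measure_cell: "dx > 0 \<Longrightarrow> measure lebesgue (cell dx j) = dx"
  by (simp add: cell_def)

lemma emeasure_cell: "emeasure lebesgue (cell dx j) < \<infinity>"
  by (cases "dx > 0") (auto simp: cell_def)

lemmas L2_cell_integrable = L2_set_integrable[OF _ cell_measurable emeasure_cell]

lemma integral_cell_const: "dx > 0 \<Longrightarrow> (LINT x:cell dx j|lebesgue. k) = k * dx" for k :: real
  using emeasure_cell[of dx j] cell_measurable[of dx j]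
  by (simp add: set_lebesgue_integral_def measure_cell)

lemma integrable_cell_const: "set_integrable lebesgue (cell dx j) (\<lambda>x. k)" for k :: real
  unfolding set_integrable_def using emeasure_cell[of dx j] cell_measurable by simp

lemma disjoint_cells: "dx > 0 \<Longrightarrow> disjoint_family_on (cell dx) J"
proof (unfold disjoint_family_on_def, intro ballI impI)
  fix i j :: int assume dx: "dx > 0" and "i \<noteq> j"
  have False if x: "x \<in> cell dx i" "x \<in> cell dx j" for x
  proof -
    have "of_int i * dx - dx < of_int j * dx" "of_int j * dx - dx < of_int i * dx"
      using x by (auto simp: cell_def)
    then have "(of_int i - 1) * dx < of_int j * dx" "(of_int j - 1) * dx < of_int i * dx"
      by (auto simp: algebra_simps)
    then have "of_int i - 1 < (of_int j :: real)" "of_int j - 1 < (of_int i :: real)"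
      using dx by auto
    then show False using \<open>i \<noteq> j\<close> by linarith
  qed
  then show "cell dx i \<inter> cell dx j = {}" by blast
qed

lemma sum_integral_cells_le:
  fixes f :: "real \<Rightarrow> real"
  assumes "integrable lebesgue f" "\<And>x. 0 \<le> f x" "dx > 0" "finite J"
  shows "(\<Sum>j\<in>J. LINT x:cell dx j|lebesgue. f x) \<le> (LINT x|lebesgue. f x)"
proof -
  have "set_integrable lebesgue (cell dx j) f" for j
    unfolding set_integrable_def using assms(1) cell_measurable by (rule integrable_mult_indicator[rotated])
  then have "(\<Sum>j\<in>J. LINT x:cell dx j|lebesgue. f x) = (LINT x:(\<Union>j\<in>J. cell dx j)|lebesgue. f x)"
    using assms by (intro set_integral_finite_Union[symmetric] disjoint_cells cell_measurable)
  also have "\<dots> \<le> (LINT x|lebesgue. f x)"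
  proof -
    have "(\<Union>j\<in>J. cell dx j) \<in> sets lebesgue"
      using assms(4) by (auto intro!: sets.finite_UN simp: cell_measurable)
    then show ?thesis unfolding set_lebesgue_integral_def
      using assms(1,2) by (intro integral_mono integrable_mult_indicator) (auto simp: indicator_def)
  qed
  finally show ?thesis .
qed

text \<open>Cauchy-Schwarz, in the form that the variance of \<open>f\<close> on a cell is nonnegative.\<close>

lemma integral_cell_squared_le:
  assumes "L2_fun f" "dx > 0"
  shows "(LINT x:cell dx j|lebesgue. f x)\<^sup>2 \<le> dx * (LINT x:cell dx j|lebesgue. (f x)\<^sup>2)"
proof -
  note int = L2_cell_integrable[OF assms(1), where dx = dx and j = j]
  define I where "I = (LINT x:cell dx j|lebesgue. f x)"
  define m where "m = I / dx"
  have "0 \<le> (LINT x:cell dx j|lebesgue. (f x - m)\<^sup>2)"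
    unfolding set_lebesgue_integral_def by (rule Bochner_Integration.integral_nonneg) auto
  also have "\<dots> = (LINT x:cell dx j|lebesgue. (f x)\<^sup>2 - 2 * m * f x + m\<^sup>2)"
    by (simp add: power2_diff algebra_simps)
  also have "\<dots> = (LINT x:cell dx j|lebesgue. (f x)\<^sup>2) - 2 * m * I + m\<^sup>2 * dx"
    using int assms(2) unfolding I_def
    by (subst set_integral_add set_integral_diff; simp add: integrable_cell_const integral_cell_const)+
  also have "\<dots> = (LINT x:cell dx j|lebesgue. (f x)\<^sup>2) - I\<^sup>2 / dx"
    using assms(2) by (simp add: m_def power2_eq_square field_simps)
  finally show ?thesis using assms(2) by (simp add: I_def field_simps)
qed

lemma initial_energy_le:
  assumes "scheme_initial c dx u0 du0 v0 R S" "L2_fun v0" "L2_fun du0" "dx > 0" "finite J"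
    and c: "\<And>x. \<bar>c x\<bar> \<le> C2"
  shows "dx * (\<Sum>j\<in>J. (R 0 j)\<^sup>2 + (S 0 j)\<^sup>2)
     \<le> 2 * ((LINT x|lebesgue. (v0 x)\<^sup>2) + C2\<^sup>2 * (LINT x|lebesgue. (du0 x)\<^sup>2))"
proof -
  define V U where "V j = (LINT x:cell dx j|lebesgue. (v0 x)\<^sup>2)"
    and "U j = (LINT x:cell dx j|lebesgue. (du0 x)\<^sup>2)" for j
  have avg: "dx * (cell_average dx f j)\<^sup>2 \<le> (LINT x:cell dx j|lebesgue. (f x)\<^sup>2)" if "L2_fun f" for f j
    using integral_cell_squared_le[OF that \<open>dx > 0\<close>, of j] \<open>dx > 0\<close>
    by (simp add: cell_average_def power2_eq_square field_simps)
  have "dx * ((R 0 j)\<^sup>2 + (S 0 j)\<^sup>2) \<le> 2 * (V j + C2\<^sup>2 * U j)" for j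
  proof -
    define k where "k = c (u0 (of_int j * dx))"
    have "R 0 j = cell_average dx v0 j + k * cell_average dx du0 j"
      "S 0 j = cell_average dx v0 j - k * cell_average dx du0 j"
      using assms(1) unfolding scheme_initial_def k_def by auto
    note RS = this
    have "dx * ((R 0 j)\<^sup>2 + (S 0 j)\<^sup>2) = 2 * (dx * (cell_average dx v0 j)\<^sup>2 + k\<^sup>2 * (dx * (cell_average dx du0 j)\<^sup>2))"
      unfolding RS by (simp add: power2_eq_square algebra_simps)
    also have "\<dots> \<le> 2 * (V j + C2\<^sup>2 * U j)"
    proof -
      have "k\<^sup>2 \<le> C2\<^sup>2" using c[of "u0 (of_int j * dx)"] unfolding k_def
        by (metis abs_ge_zero power2_abs power_mono)
      then have "k\<^sup>2 * (dx * (cell_average dx du0 j)\<^sup>2) \<le> C2\<^sup>2 * U j"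
        unfolding U_def using \<open>dx > 0\<close> by (intro mult_mono avg assms) auto
      then show ?thesis using avg[OF assms(2), of j] by (simp add: V_def)
    qed
    finally show ?thesis .
  qed
  then have "dx * (\<Sum>j\<in>J. (R 0 j)\<^sup>2 + (S 0 j)\<^sup>2) \<le> (\<Sum>j\<in>J. 2 * (V j + C2\<^sup>2 * U j))"
    unfolding sum_distrib_left by (intro sum_mono)
  also have "\<dots> = 2 * ((\<Sum>j\<in>J. V j) + C2\<^sup>2 * (\<Sum>j\<in>J. U j))"
    by (simp add: sum.distrib sum_distrib_left)
  also have "\<dots> \<le> 2 * ((LINT x|lebesgue. (v0 x)\<^sup>2) + C2\<^sup>2 * (LINT x|lebesgue. (du0 x)\<^sup>2))"
    unfolding V_def U_def using assms(2,3,4,5)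
    by (intro mult_left_mono add_mono sum_integral_cells_le) (auto simp: L2_fun_def)
  finally show ?thesis .
qed

text \<open>Replacing \<open>c (u0 x)\<close> by the value at the grid point in the nonpositive function
\<open>v0 + s c(u0) du0\<close> costs at most \<open>L D \<bar>du0\<bar>\<close>, where \<open>D\<close> is the integral of \<open>\<bar>du0\<bar>\<close> over
the cell and bounds the oscillation of \<open>u0\<close>. The signs \<open>s = 1\<close> and \<open>s = - 1\<close> give \<open>R\<close> and \<open>S\<close>.\<close>

lemma initial_one_sided_bound:
  fixes c u0 du0 v0 :: "real \<Rightarrow> real"
  assumes H: "has_H1_derivative u0 du0" and cont: "continuous_on UNIV u0" and v0: "L2_fun v0"
    and lip: "\<And>x y. \<bar>c x - c y\<bar> \<le> L * \<bar>x - y\<bar>" and L: "L \<ge> 0" and "dx > 0"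
    and s: "\<bar>s\<bar> = 1" and neg: "AE x in lebesgue. v0 x + s * (c (u0 x) * du0 x) \<le> 0"
  shows "cell_average dx v0 j + s * (c (u0 (of_int j * dx)) * cell_average dx du0 j)
     \<le> L * (LINT x:cell dx j|lebesgue. (du0 x)\<^sup>2)"
proof -
  have du0: "L2_fun du0" using H by (simp add: has_H1_derivative_def)
  note int = L2_cell_integrable[OF du0, where dx = dx and j = j] L2_cell_integrable[OF v0, where dx = dx and j = j]
  define xj where "xj = of_int j * dx"
  define k where "k = c (u0 xj)"
  define D where "D = (LINT x:cell dx j|lebesgue. \<bar>du0 x\<bar>)"
  have xj: "xj \<in> cell dx j" using \<open>dx > 0\<close> by (simp add: cell_def xj_def)
  have osc: "\<bar>u0 y - u0 x\<bar> \<le> D" if "x < y" "x \<in> cell dx j" "y \<in> cell dx j" for x y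
  proof -
    have "\<bar>u0 y - u0 x\<bar> = \<bar>LINT z:{x<..y}|lebesgue. du0 z\<bar>"
      using H1_fundamental_theorem[OF H cont that(1)] by simp
    also have "\<dots> \<le> (LINT z:{x<..y}|lebesgue. \<bar>du0 z\<bar>)"
      using set_integral_norm_bound[OF L2_set_integrable(1)[OF du0], of "{x<..y}"]
      by (simp add: less_imp_le[OF that(1)])
    also have "\<dots> \<le> D"
      using that int(3) unfolding D_def set_lebesgue_integral_def
      by (intro integral_mono L2_set_integrable(3)[OF du0, unfolded set_integrable_def])
        (auto simp: cell_def indicator_def set_integrable_def less_imp_le)
    finally show ?thesis .
  qed
  have D0: "D \<ge> 0" unfolding D_def set_lebesgue_integral_def by (rule Bochner_Integration.integral_nonneg) auto
  have osc': "\<bar>u0 x - u0 xj\<bar> \<le> D" if "x \<in> cell dx j" for x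
    using osc[of x xj] osc[of xj x] that xj D0 by (cases x xj rule: linorder_cases) (auto simp: abs_minus_commute)
  have "AE x in lebesgue. x \<in> cell dx j \<longrightarrow> v0 x + s * (k * du0 x) \<le> L * D * \<bar>du0 x\<bar>"
    using neg
  proof eventually_elim
    case (elim x)
    show ?case
    proof
      assume x: "x \<in> cell dx j"
      have "v0 x + s * (k * du0 x) \<le> s * ((k - c (u0 x)) * du0 x)"
        using elim by (simp add: algebra_simps)
      also have "\<dots> \<le> \<bar>s * ((k - c (u0 x)) * du0 x)\<bar>" by simp
      also have "\<dots> = \<bar>k - c (u0 x)\<bar> * \<bar>du0 x\<bar>" by (simp add: abs_mult s)
      also have "\<dots> \<le> (L * D) * \<bar>du0 x\<bar>"
      proof (rule mult_right_mono)
        have "\<bar>k - c (u0 x)\<bar> \<le> L * \<bar>u0 xj - u0 x\<bar>" unfolding k_def by (rule lip)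
        also have "\<dots> \<le> L * D" using osc'[OF x] L by (intro mult_left_mono) (auto simp: abs_minus_commute)
        finally show "\<bar>k - c (u0 x)\<bar> \<le> L * D" .
      qed simp
      finally show "v0 x + s * (k * du0 x) \<le> L * D * \<bar>du0 x\<bar>" .
    qed
  qed
  then have "(LINT x:cell dx j|lebesgue. v0 x + s * (k * du0 x)) \<le> (LINT x:cell dx j|lebesgue. L * D * \<bar>du0 x\<bar>)"
    using int by (intro set_integral_mono_AE) auto
  moreover have "(LINT x:cell dx j|lebesgue. v0 x + s * (k * du0 x))
     = (LINT x:cell dx j|lebesgue. v0 x) + s * (k * (LINT x:cell dx j|lebesgue. du0 x))"
    using int by (subst set_integral_add) auto
  moreover have "(LINT x:cell dx j|lebesgue. L * D * \<bar>du0 x\<bar>) = L * D\<^sup>2"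
    by (simp add: D_def power2_eq_square)
  moreover have "D\<^sup>2 \<le> dx * (LINT x:cell dx j|lebesgue. (du0 x)\<^sup>2)"
  proof -
    have "(\<lambda>x. norm (du0 x)) \<in> borel_measurable lebesgue"
      using du0 by (auto simp: L2_fun_def intro: measurable_compose[OF _ borel_measurable_norm])
    then have "L2_fun (\<lambda>x. \<bar>du0 x\<bar>)" using du0 by (simp add: L2_fun_def)
    from integral_cell_squared_le[OF this \<open>dx > 0\<close>, of j] show ?thesis by (simp add: D_def)
  qed
  ultimately have "(LINT x:cell dx j|lebesgue. v0 x) + s * (k * (LINT x:cell dx j|lebesgue. du0 x))
     \<le> L * (dx * (LINT x:cell dx j|lebesgue. (du0 x)\<^sup>2))"
    using L by (smt (verit) mult_left_mono)
  then show ?thesis using \<open>dx > 0\<close> unfolding cell_average_def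
    by (simp add: k_def xj_def field_simps)
qed

text \<open>Truncation: the part of \<open>f\<close> above a high level \<open>n\<close> has small integral over the whole line, and
the rest contributes at most \<open>n\<close> times the length of the cell.\<close>

lemma integral_cell_uniformly_small:
  fixes f :: "real \<Rightarrow> real"
  assumes f: "integrable lebesgue f" "\<And>x. 0 \<le> f x" and "\<epsilon> > 0"
  obtains \<delta> where "\<delta> > 0" "\<And>dx j. 0 < dx \<Longrightarrow> dx < \<delta> \<Longrightarrow> (LINT x:cell dx j|lebesgue. f x) < \<epsilon>"
proof -
  have "(\<lambda>n. LINT x|lebesgue. f x - min (f x) (real n)) \<longlonglongrightarrow> (LINT x::real|lebesgue. 0)"
  proof (rule integral_dominated_convergence[OF _ _ f(1)])
    have "(\<lambda>n. f x - min (f x) (real n)) \<longlonglongrightarrow> 0" for x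
    proof (rule tendsto_eventually)
      obtain N :: nat where "f x \<le> real N" using real_arch_simple by blast
      then show "\<forall>\<^sub>F n in sequentially. f x - min (f x) (real n) = 0"
        unfolding eventually_sequentially by (intro exI[of _ N]) auto
    qed
    then show "AE x in lebesgue. (\<lambda>n. f x - min (f x) (real n)) \<longlonglongrightarrow> 0" by simp
    show "AE x in lebesgue. norm (f x - min (f x) (real n)) \<le> f x" for n
      using f(2) by (intro always_eventually allI) auto
    show "(\<lambda>x. f x - min (f x) (real n)) \<in> borel_measurable lebesgue" for n
      using borel_measurable_integrable[OF f(1)] by (intro borel_measurable_diff borel_measurable_min) auto
  qed simp
  then have "\<forall>\<^sub>F n in sequentially. (LINT x|lebesgue. f x - min (f x) (real n)) < \<epsilon> / 2"
    using \<open>\<epsilon> > 0\<close> by (intro order_tendstoD(2)) auto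
  then obtain n where n: "(LINT x|lebesgue. f x - min (f x) (real n)) < \<epsilon> / 2"
    by (auto simp: eventually_sequentially)
  define \<delta> where "\<delta> = \<epsilon> / (2 * (real n + 1))"
  have small: "(LINT x:cell dx j|lebesgue. f x) < \<epsilon>" if "0 < dx" "dx < \<delta>" for dx j
  proof -
    have imin: "integrable lebesgue (\<lambda>x. f x - min (f x) (real n))"
      by (rule Bochner_Integration.integrable_bound[OF f(1)])
        (use borel_measurable_integrable[OF f(1)] f(2) in \<open>auto intro!: borel_measurable_diff borel_measurable_min\<close>)
    have restr: "set_integrable lebesgue (cell dx j) g" if "integrable lebesgue g" for g :: "real \<Rightarrow> real"
      unfolding set_integrable_def using that cell_measurable by (rule integrable_mult_indicator[rotated])
    have "(LINT x:cell dx j|lebesgue. f x) \<le> (LINT x:cell dx j|lebesgue. (f x - min (f x) (real n)) + real n)"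
      using restr[OF f(1)] restr[OF imin] by (intro set_integral_mono set_integral_add integrable_cell_const) auto
    also have "\<dots> = (LINT x:cell dx j|lebesgue. (f x - min (f x) (real n))) + real n * dx"
      using restr[OF imin] that by (subst set_integral_add) (auto simp: integrable_cell_const integral_cell_const)
    also have "(LINT x:cell dx j|lebesgue. (f x - min (f x) (real n))) \<le> (LINT x|lebesgue. f x - min (f x) (real n))"
      using sum_integral_cells_le[OF imin _ \<open>0 < dx\<close>, of "{j}"] by simp
    also have "real n * dx \<le> \<epsilon> / 2"
    proof -
      have "real n * dx \<le> (real n + 1) * \<delta>" using that by (intro mult_mono) auto
      also have "\<dots> = \<epsilon> / 2" by (simp add: \<delta>_def field_simps)
      finally show ?thesis .
    qed
    finally show ?thesis using n by simp
  qed
  have "\<delta> > 0" using \<open>\<epsilon> > 0\<close> by (simp add: \<delta>_def)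
  then show ?thesis using small that by blast
qed

section \<open>Curves of summable sequences and comparison\<close>

lemma l1_abs_summable:
  assumes "l1_continuous T K" "t \<in> {0..T}"
  shows "(\<lambda>j. norm (K t j)) summable_on A"
  using assms summable_on_subset_banach[of "\<lambda>j. \<bar>K t j\<bar>" UNIV A] by (simp add: l1_continuous_def)

lemma l1_diff_abs_summable:
  fixes K :: "real \<Rightarrow> int \<Rightarrow> real"
  assumes "l1_continuous T K" "s \<in> {0..T}" "t \<in> {0..T}"
  shows "(\<lambda>j. norm (K s j - K t j)) summable_on A"
proof -
  have "(\<lambda>j. \<bar>K s j\<bar> + \<bar>K t j\<bar>) summable_on A"
    using l1_abs_summable[OF assms(1,2), of A] l1_abs_summable[OF assms(1,3), of A]
    by (auto intro: summable_on_add)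
  then have "(\<lambda>j. norm (\<bar>K s j\<bar> + \<bar>K t j\<bar>)) summable_on A" by simp
  then show ?thesis by (rule Infinite_Sum.abs_summable_on_comparison_test) auto
qed

lemma infsum_diff_real:
  fixes f g :: "'a \<Rightarrow> real"
  assumes "f summable_on A" "g summable_on A"
  shows "infsum (\<lambda>x. f x - g x) A = infsum f A - infsum g A"
proof -
  have "infsum (\<lambda>x. f x + - g x) A = infsum f A + infsum (\<lambda>x. - g x) A"
    using assms by (intro infsum_add summable_on_uminus[THEN iffD2])
  then show ?thesis by (simp add: infsum_uminus)
qed

lemma l1_infsum_diff_le:
  fixes K :: "real \<Rightarrow> int \<Rightarrow> real"
  assumes "l1_continuous T K" "s \<in> {0..T}" "t \<in> {0..T}"
  shows "\<bar>infsum (K s) A - infsum (K t) A\<bar> \<le> (\<Sum>\<^sub>\<infinity>j. \<bar>K s j - K t j\<bar>)"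
proof -
  note sm = l1_abs_summable[OF assms(1,2), THEN Infinite_Sum.abs_summable_summable, of A]
    l1_abs_summable[OF assms(1,3), THEN Infinite_Sum.abs_summable_summable, of A]
  have "infsum (\<lambda>j. K s j - K t j) A = infsum (K s) A - infsum (K t) A"
    using sm by (rule infsum_diff_real)
  then have "\<bar>infsum (K s) A - infsum (K t) A\<bar> \<le> infsum (\<lambda>j. \<bar>K s j - K t j\<bar>) A"
    using norm_infsum_bound[OF l1_diff_abs_summable[OF assms, of A]] by simp
  also have "\<dots> \<le> infsum (\<lambda>j. \<bar>K s j - K t j\<bar>) UNIV"
    using l1_diff_abs_summable[OF assms, of A] l1_diff_abs_summable[OF assms, of UNIV]
    by (intro infsum_mono2) auto
  finally show ?thesis by simp
qed

lemma l1_infsum_continuous_on: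
  fixes K :: "real \<Rightarrow> int \<Rightarrow> real"
  assumes "l1_continuous T K"
  shows "continuous_on {0..T} (\<lambda>t. infsum (K t) A)"
  unfolding continuous_on_def
proof
  fix t assume t: "t \<in> {0..T}"
  have "((\<lambda>s. \<Sum>\<^sub>\<infinity>j. \<bar>K s j - K t j\<bar>) \<longlongrightarrow> 0) (at t within {0..T})"
    using assms t by (simp add: l1_continuous_def)
  then have "((\<lambda>s. infsum (K s) A - infsum (K t) A) \<longlongrightarrow> 0) (at t within {0..T})"
    by (rule Lim_null_comparison[rotated])
      (use t l1_infsum_diff_le[OF assms] in \<open>auto simp: eventually_at_filter\<close>)
  then show "((\<lambda>s. infsum (K s) A) \<longlongrightarrow> infsum (K t) A) (at t within {0..T})"
    by (rule Lim_null[THEN iffD2])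
qed

lemma l1_abs_continuous:
  assumes "l1_continuous T K"
  shows "l1_continuous T (\<lambda>t j. \<bar>K t j\<bar>)"
  unfolding l1_continuous_def
proof (intro conjI ballI)
  fix t assume t: "t \<in> {0..T}"
  show "(\<lambda>j. \<bar>\<bar>K t j\<bar>\<bar>) summable_on UNIV" using assms t by (simp add: l1_continuous_def)
  have "((\<lambda>s. \<Sum>\<^sub>\<infinity>j. \<bar>K s j - K t j\<bar>) \<longlongrightarrow> 0) (at t within {0..T})"
    using assms t by (simp add: l1_continuous_def)
  then show "((\<lambda>s. \<Sum>\<^sub>\<infinity>j. \<bar>\<bar>K s j\<bar> - \<bar>K t j\<bar>\<bar>) \<longlongrightarrow> 0) (at t within {0..T})"
  proof (rule Lim_null_comparison[rotated])
    have "\<bar>\<Sum>\<^sub>\<infinity>j. \<bar>\<bar>K s j\<bar> - \<bar>K t j\<bar>\<bar>\<bar> \<le> (\<Sum>\<^sub>\<infinity>j. \<bar>K s j - K t j\<bar>)" if s: "s \<in> {0..T}" for s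
    proof -
      have "(\<lambda>j. norm \<bar>\<bar>K s j\<bar> - \<bar>K t j\<bar>\<bar>) summable_on UNIV"
        using l1_diff_abs_summable[OF assms s t, of UNIV]
        by (rule Infinite_Sum.abs_summable_on_comparison_test) auto
      then have "(\<Sum>\<^sub>\<infinity>j. \<bar>\<bar>K s j\<bar> - \<bar>K t j\<bar>\<bar>) \<le> (\<Sum>\<^sub>\<infinity>j. \<bar>K s j - K t j\<bar>)"
        using l1_diff_abs_summable[OF assms s t, of UNIV] by (intro infsum_mono) auto
      moreover have "0 \<le> (\<Sum>\<^sub>\<infinity>j. \<bar>\<bar>K s j\<bar> - \<bar>K t j\<bar>\<bar>)" by (rule infsum_nonneg) auto
      ultimately show ?thesis by simp
    qed
    then show "\<forall>\<^sub>F s in at t within {0..T}. norm (\<Sum>\<^sub>\<infinity>j. \<bar>\<bar>K s j\<bar> - \<bar>K t j\<bar>\<bar>) \<le> (\<Sum>\<^sub>\<infinity>j. \<bar>K s j - K t j\<bar>)"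
      by (auto simp: eventually_at_filter)
  qed
qed

lemma l1_bounded_square_sum:
  assumes "l1_continuous T K"
  obtains B where "\<And>t J. t \<in> {0..T} \<Longrightarrow> finite J \<Longrightarrow> (\<Sum>j\<in>J. (K t j)\<^sup>2) \<le> B"
proof -
  define n where "n t = (\<Sum>\<^sub>\<infinity>j. \<bar>K t j\<bar>)" for t
  have "continuous_on {0..T} n"
    unfolding n_def using l1_infsum_continuous_on[OF l1_abs_continuous[OF assms]] .
  then have "bounded (n ` {0..T})"
    by (intro compact_imp_bounded compact_continuous_image) auto
  then obtain M where "\<forall>v \<in> n ` {0..T}. norm v \<le> M" unfolding bounded_iff by blast
  then have M: "n t \<le> M" if "t \<in> {0..T}" for t
  proof -
    have "norm (n t) \<le> M" using that \<open>\<forall>v \<in> n ` {0..T}. norm v \<le> M\<close> by blast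
    then show ?thesis by simp
  qed
  show ?thesis
  proof (rule that[of "M * M"])
    fix t and J :: "int set" assume t: "t \<in> {0..T}" and J: "finite J"
    have sum_le: "(\<Sum>j\<in>I. \<bar>K t j\<bar>) \<le> M" if "finite I" for I
    proof -
      have "(\<Sum>j\<in>I. \<bar>K t j\<bar>) \<le> n t"
        unfolding n_def using l1_abs_summable[OF assms t, of UNIV] that
        by (intro finite_sum_le_infsum) auto
      then show ?thesis using M[OF t] by simp
    qed
    have "(\<Sum>j\<in>J. (K t j)\<^sup>2) \<le> (\<Sum>j\<in>J. M * \<bar>K t j\<bar>)"
    proof (rule sum_mono)
      fix j
      have "\<bar>K t j\<bar> * \<bar>K t j\<bar> \<le> M * \<bar>K t j\<bar>" using sum_le[of "{j}"] by (intro mult_right_mono) auto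
      then show "(K t j)\<^sup>2 \<le> M * \<bar>K t j\<bar>" by (simp add: power2_eq_square abs_mult_self_eq)
    qed
    also have "\<dots> \<le> M * M"
      using sum_le[OF J] sum_le[of "{}"] unfolding sum_distrib_left[symmetric]
      by (intro mult_left_mono) auto
    finally show "(\<Sum>j\<in>J. (K t j)\<^sup>2) \<le> M * M" .
  qed
qed

text \<open>At a fixed time only finitely many entries reach \<open>\<epsilon> / 2\<close>, and at nearby times
all others stay below \<open>\<epsilon>\<close>. Compactness of the time interval reduces to finitely many such sets.\<close>

lemma l1_uniform_tail:
  assumes "l1_continuous T K" "\<epsilon> > 0"
  obtains J where "finite J" "\<And>t j. t \<in> {0..T} \<Longrightarrow> j \<notin> J \<Longrightarrow> \<bar>K t j\<bar> < \<epsilon>"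
proof -
  define J where "J t = {j. \<epsilon> / 2 \<le> \<bar>K t j\<bar>}" for t
  have fin: "finite (J t)" if t: "t \<in> {0..T}" for t
  proof -
    define n where "n = (\<Sum>\<^sub>\<infinity>j. \<bar>K t j\<bar>)"
    have "card G \<le> nat \<lceil>2 * n / \<epsilon>\<rceil>" if G: "G \<subseteq> J t" "finite G" for G
    proof -
      have "real (card G) * (\<epsilon> / 2) = (\<Sum>j\<in>G. \<epsilon> / 2)" by simp
      also have "\<dots> \<le> (\<Sum>j\<in>G. \<bar>K t j\<bar>)" using G by (intro sum_mono) (auto simp: J_def)
      also have "\<dots> \<le> n" unfolding n_def using l1_abs_summable[OF assms(1) t, of UNIV] G
        by (intro finite_sum_le_infsum) auto
      finally have "real (card G) \<le> 2 * n / \<epsilon>" using assms(2) by (simp add: field_simps)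
      then show ?thesis by linarith
    qed
    then show ?thesis using finite_if_finite_subsets_card_bdd by blast
  qed
  have "\<exists>\<delta>>0. \<forall>s\<in>{0..T}. dist s t < \<delta> \<longrightarrow> (\<Sum>\<^sub>\<infinity>j. \<bar>K s j - K t j\<bar>) < \<epsilon> / 2" if t: "t \<in> {0..T}" for t
  proof -
    have "((\<lambda>s. \<Sum>\<^sub>\<infinity>j. \<bar>K s j - K t j\<bar>) \<longlongrightarrow> 0) (at t within {0..T})"
      using assms t by (simp add: l1_continuous_def)
    then have "\<forall>\<^sub>F s in at t within {0..T}. (\<Sum>\<^sub>\<infinity>j. \<bar>K s j - K t j\<bar>) < \<epsilon> / 2"
      using assms(2) by (intro order_tendstoD(2)) auto
    then obtain \<delta> where "\<delta> > 0" and \<delta>: "\<And>s. s \<in> {0..T} \<Longrightarrow> s \<noteq> t \<Longrightarrow> dist s t < \<delta> \<Longrightarrow> (\<Sum>\<^sub>\<infinity>j. \<bar>K s j - K t j\<bar>) < \<epsilon> / 2"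
      unfolding eventually_at by blast
    moreover have "(\<Sum>\<^sub>\<infinity>j. \<bar>K t j - K t j\<bar>) < \<epsilon> / 2" using assms(2) by simp
    ultimately show ?thesis by metis
  qed
  then obtain \<delta> where \<delta>: "\<And>t. t \<in> {0..T} \<Longrightarrow> \<delta> t > 0"
    "\<And>s t. t \<in> {0..T} \<Longrightarrow> s \<in> {0..T} \<Longrightarrow> dist s t < \<delta> t \<Longrightarrow> (\<Sum>\<^sub>\<infinity>j. \<bar>K s j - K t j\<bar>) < \<epsilon> / 2"
    by metis
  obtain D where D: "D \<subseteq> {0..T}" "finite D" "{0..T} \<subseteq> (\<Union>t\<in>D. ball t (\<delta> t))"
  proof (rule compactE_image[of "{0..T}" "{0..T}" "\<lambda>t. ball t (\<delta> t)"])
    show "{0..T} \<subseteq> (\<Union>t\<in>{0..T}. ball t (\<delta> t))" using \<delta>(1) by fastforce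
  qed auto
  show ?thesis
  proof (rule that[of "\<Union>t\<in>D. J t"])
    show "finite (\<Union>t\<in>D. J t)" using D fin by blast
    fix s j assume s: "s \<in> {0..T}" and j: "j \<notin> (\<Union>t\<in>D. J t)"
    obtain t where t: "t \<in> D" "dist t s < \<delta> t" using D(3) s by auto
    have "\<bar>K s j - K t j\<bar> \<le> (\<Sum>\<^sub>\<infinity>j. \<bar>K s j - K t j\<bar>)"
      using finite_sum_le_infsum[of "\<lambda>j. \<bar>K s j - K t j\<bar>" UNIV "{j}"]
        l1_diff_abs_summable[OF assms(1) s, of t UNIV] t D(1) by auto
    also have "\<dots> < \<epsilon> / 2" using t D(1) s by (intro \<delta>(2)) (auto simp: dist_commute)
    finally have "\<bar>K s j - K t j\<bar> < \<epsilon> / 2" .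
    moreover have "\<bar>K t j\<bar> < \<epsilon> / 2" using j t(1) by (auto simp: J_def)
    ultimately show "\<bar>K s j\<bar> < \<epsilon>" by linarith
  qed
qed

text \<open>Each \<open>X j\<close> stays below the solution \<open>z\<close> of \<open>z' = 2 \<kappa> z\<^sup>2\<close>, \<open>z 0 = \<epsilon>\<close>, which does not exceed
\<open>2 \<epsilon>\<close> on the time interval. At a first time of contact the index is a spatial maximum,
so the difference term is nonpositive and \<open>X j\<close> grows at a rate at most \<open>\<kappa> z\<^sup>2\<close>, strictly less than
\<open>z'\<close>. Only finitely many indices can reach \<open>z \<ge> \<epsilon>\<close>, so that a first contact exists.\<close>

lemma one_sided_comparison:
  fixes X :: "real \<Rightarrow> int \<Rightarrow> real"
  assumes l1: "l1_continuous T X"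
    and der: "\<And>t j. t \<in> {0..T} \<Longrightarrow> ((\<lambda>s. X s j) has_real_derivative D t j) (at t within {0..T})"
    and le: "\<And>t j. t \<in> {0..T} \<Longrightarrow> \<exists>i. \<exists>k\<ge>0. D t j \<le> k * (X t i - X t j) + \<kappa> * (X t j)\<^sup>2"
    and pos: "\<kappa> > 0" "\<epsilon> > 0" and time: "4 * \<kappa> * \<epsilon> * T \<le> 1"
    and init: "\<And>j. X 0 j < \<epsilon>" and t: "t \<in> {0..T}"
  shows "X t j \<le> 2 * \<epsilon>"
proof -
  define z where "z t = \<epsilon> / (1 - 2 * \<kappa> * \<epsilon> * t)" for t
  have den: "1 / 2 \<le> 1 - 2 * \<kappa> * \<epsilon> * t" "1 - 2 * \<kappa> * \<epsilon> * t \<le> 1" if "t \<in> {0..T}" for t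
  proof -
    have "2 * \<kappa> * \<epsilon> * t \<le> 2 * \<kappa> * \<epsilon> * T" using that pos by (intro mult_left_mono) auto
    then show "1 / 2 \<le> 1 - 2 * \<kappa> * \<epsilon> * t" using time by linarith
    show "1 - 2 * \<kappa> * \<epsilon> * t \<le> 1" using that pos by simp
  qed
  have z: "\<epsilon> \<le> z t" "z t \<le> 2 * \<epsilon>" if "t \<in> {0..T}" for t
  proof -
    have "\<epsilon> * (1 - 2 * \<kappa> * \<epsilon> * t) \<le> \<epsilon> * 1" "\<epsilon> * (1 / 2) \<le> \<epsilon> * (1 - 2 * \<kappa> * \<epsilon> * t)"
      using den[OF that] pos by (auto intro!: mult_left_mono)
    then show "\<epsilon> \<le> z t" "z t \<le> 2 * \<epsilon>" using den[OF that] unfolding z_def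
      by (auto simp: le_divide_eq divide_le_eq)
  qed
  have z': "(z has_real_derivative 2 * \<kappa> * (z t)\<^sup>2) (at t within {0..T})" if "t \<in> {0..T}" for t
    unfolding z_def using den(1)[OF that]
    by (auto intro!: derivative_eq_intros simp: power2_eq_square)
  obtain J where J: "finite J" "\<And>t j. t \<in> {0..T} \<Longrightarrow> j \<notin> J \<Longrightarrow> \<bar>X t j\<bar> < \<epsilon>"
    using l1_uniform_tail[OF l1 pos(2)] by blast
  define g where "g j t = X t j - z t" for j t
  have g': "(g j has_real_derivative D t j - 2 * \<kappa> * (z t)\<^sup>2) (at t within {0..T})" if "t \<in> {0..T}" for j t
    unfolding g_def by (intro DERIV_diff der z' that)
  have gcont: "continuous_on {0..T} (g j)" for j
    using g' by (rule DERIV_continuous_on)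
  \<comment> \<open>The set of contact times, closed as a finite union of closed sets.\<close>
  define B where "B = (\<Union>j\<in>J. {0..T} \<inter> g j -` {0..})"
  have "B = {}"
  proof (rule ccontr)
    assume "B \<noteq> {}"
    have "closed B" unfolding B_def
      using J(1) by (intro closed_UN ballI continuous_closed_preimage[OF gcont]) auto
    moreover have "B \<subseteq> {0..T}" by (auto simp: B_def)
    ultimately have "compact B" by (meson bounded_closed_interval bounded_subset compact_eq_bounded_closed)
    then obtain r where r: "r \<in> B" "\<And>s. s \<in> B \<Longrightarrow> r \<le> s"
      using compact_attains_inf[OF _ \<open>B \<noteq> {}\<close>] by metis
    have rT: "r \<in> {0..T}" using r by (auto simp: B_def)
    have Jne: "J \<noteq> {}" using r by (auto simp: B_def)
    have "Max (X r ` J) \<in> X r ` J" using J(1) Jne by simp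
    then obtain i where "i \<in> J" "X r i = Max (X r ` J)" by auto
    then have i: "i \<in> J" "X r j \<le> X r i" if "j \<in> J" for j
      using J(1) that by auto
    have iJ: "i \<in> J" using \<open>i \<in> J\<close> .
    have gi: "0 \<le> g i r"
    proof -
      obtain j where "j \<in> J" "0 \<le> g j r" using r(1) by (auto simp: B_def)
      then show ?thesis using i(2)[of j] by (auto simp: g_def)
    qed
    have below: "g i s < 0" if "s \<in> {0..T}" "s < r" for s
    proof (rule ccontr)
      assume "\<not> g i s < 0"
      then have "s \<in> B" using that iJ unfolding B_def by (intro UN_I[of i]) auto
      then show False using r(2)[of s] that by simp
    qed
    \<comment> \<open>An index outside \<open>J\<close> stays below \<open>\<epsilon>\<close>, hence below the touching value.\<close>
    have top: "X r j \<le> X r i" for j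
    proof (cases "j \<in> J")
      case False
      then show ?thesis using J(2)[OF rT False] gi z(1)[OF rT] by (auto simp: g_def)
    qed (rule i)
    have "r > 0"
    proof -
      have "r \<noteq> 0" using gi init[of i] by (auto simp: g_def z_def)
      then show ?thesis using rT by simp
    qed
    have gi0: "g i r = 0"
    proof (rule ccontr)
      assume "g i r \<noteq> 0"
      have "\<exists>s. 0 \<le> s \<and> s \<le> r \<and> g i s = 0"
      proof (rule IVT')
        show "g i 0 \<le> 0" using below[of 0] rT \<open>r > 0\<close> by simp
        show "continuous_on {0..r} (g i)" by (rule continuous_on_subset[OF gcont]) (use rT in auto)
      qed (use gi rT in auto)
      then obtain s where s: "0 \<le> s" "s \<le> r" "g i s = 0" by blast
      then have "s < r" using \<open>g i r \<noteq> 0\<close> by (cases "s = r") auto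
      then show False using below[of s] s rT by auto
    qed
    have "D r i - 2 * \<kappa> * (z r)\<^sup>2 < 0"
    proof -
      obtain l k where k: "k \<ge> 0" "D r i \<le> k * (X r l - X r i) + \<kappa> * (X r i)\<^sup>2"
        using le[OF rT] by blast
      have "k * (X r l - X r i) \<le> 0" using k(1) top[of l] by (simp add: mult_le_0_iff)
      moreover have "X r i = z r" using gi0 by (simp add: g_def)
      moreover have "0 < \<kappa> * (z r)\<^sup>2" using pos z(1)[OF rT] by simp
      ultimately show ?thesis using k(2) by simp
    qed
    from has_real_derivative_neg_dec_left[OF g'[OF rT] this]
    obtain d where d: "d > 0" "\<And>h. h > 0 \<Longrightarrow> r - h \<in> {0..T} \<Longrightarrow> h < d \<Longrightarrow> g i r < g i (r - h)" by blast
    define h where "h = min (d / 2) r"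
    have "0 < h" "h < d" "r - h \<in> {0..T}" using d(1) \<open>r > 0\<close> rT by (auto simp: h_def)
    then show False using d(2)[of h] below[of "r - h"] gi0 by auto
  qed
  have "X t j < z t" if "j \<in> J"
  proof (rule ccontr)
    assume "\<not> X t j < z t"
    then have "t \<in> B" using that t unfolding B_def g_def by (intro UN_I[of j]) auto
    then show False using \<open>B = {}\<close> by simp
  qed
  moreover have "X t j < z t" if "j \<notin> J" using J(2)[OF t that] z(1)[OF t] by auto
  ultimately show ?thesis using z(2)[OF t] by (meson less_le_trans less_imp_le)
qed

lemma DERIV_F_fun:
  assumes "continuous_on UNIV c"
  shows "(F_fun c has_real_derivative 2 * c u) (at u)"
proof -
  define a b where "a = min 0 u - 1" and "b = max 0 u + 1"
  have "((\<lambda>u. LBINT v=ereal 0..ereal u. 2 * c v) has_vector_derivative 2 * c u) (at u within {a..b})"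
    by (rule interval_integral_FTC2[of a 0 b])
      (auto simp: a_def b_def intro!: continuous_intros continuous_on_subset[OF assms])
  moreover have "at u within {a..b} = at u"
    by (intro at_within_interior) (auto simp: a_def b_def interior_atLeastAtMost_real)
  ultimately show ?thesis
    by (simp add: has_real_derivative_iff_has_vector_derivative F_fun_def[abs_def] zero_ereal_def)
qed

text \<open>\<open>F_fun c\<close> has slope at least \<open>2 C1\<close>, hence is onto, and its inverse has slope at most
\<open>1 / (2 C1)\<close>.\<close>

lemma inv_F_fun_lipschitz:
  assumes "continuous_on UNIV c" "C1 > 0" "\<And>x. C1 \<le> c x"
  shows "\<bar>inv (F_fun c) y - inv (F_fun c) z\<bar> \<le> \<bar>y - z\<bar> / (2 * C1)"
proof -
  note F' = DERIV_F_fun[OF assms(1)]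
  have grow: "2 * C1 * (v - u) \<le> F_fun c v - F_fun c u" if "u \<le> v" for u v
  proof -
    have "F_fun c u - 2 * C1 * u \<le> F_fun c v - 2 * C1 * v"
    proof (rule DERIV_nonneg_imp_nondecreasing[OF that])
      fix x
      have "((\<lambda>x. F_fun c x - 2 * C1 * x) has_real_derivative 2 * c x - 2 * C1) (at x)"
        by (auto intro!: derivative_eq_intros F')
      then show "\<exists>y. ((\<lambda>x. F_fun c x - 2 * C1 * x) has_real_derivative y) (at x) \<and> 0 \<le> y"
        using assms(3)[of x] by force
    qed
    then show ?thesis by (simp add: algebra_simps)
  qed
  have "F_fun c 0 = 0" by (simp add: F_fun_def zero_ereal_def[symmetric])
  have surj: "\<exists>u. F_fun c u = y" for y
  proof -
    define m where "m = \<bar>y\<bar> / (2 * C1)"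
    have m: "m \<ge> 0" "2 * C1 * m = \<bar>y\<bar>" using assms(2) by (auto simp: m_def)
    have "F_fun c (- m) \<le> y" "y \<le> F_fun c m"
      using grow[of 0 m] grow[of "- m" 0] m \<open>F_fun c 0 = 0\<close> by auto
    moreover have "continuous_on {- m..m} (F_fun c)"
      by (intro continuous_at_imp_continuous_on ballI DERIV_isCont[OF F'])
    ultimately show ?thesis using IVT'[of "F_fun c" "- m" y m] m(1) by auto
  qed
  then have F_inv: "F_fun c (inv (F_fun c) y) = y" for y by (metis f_inv_into_f rangeI)
  have "2 * C1 * \<bar>u - v\<bar> \<le> \<bar>F_fun c u - F_fun c v\<bar>" for u v
    using grow[of u v] grow[of v u] by (cases "u \<le> v") (auto simp: abs_if)
  from this[of "inv (F_fun c) y" "inv (F_fun c) z"] show ?thesis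
    using assms(2) by (simp add: F_inv field_simps)
qed

lemma u_half_continuous_on:
  assumes c: "continuous_on UNIV c" "C1 > 0" "\<And>x. C1 \<le> c x"
    and l1: "l1_continuous T R" "l1_continuous T S"
  shows "continuous_on {0..T} (\<lambda>t. u_half c dx (R t) (S t) j)"
proof -
  have "continuous_on {0..T} (\<lambda>t. dx * (infsum (R t) {..j} - infsum (S t) {..j}))"
    by (intro continuous_intros l1_infsum_continuous_on l1)
  moreover have "F_half dx (R t) (S t) j = dx * (infsum (R t) {..j} - infsum (S t) {..j})" if "t \<in> {0..T}" for t
    unfolding F_half_def
    by (simp add: infsum_diff_real[OF l1_abs_summable[OF l1(1) that, THEN Infinite_Sum.abs_summable_summable]
        l1_abs_summable[OF l1(2) that, THEN Infinite_Sum.abs_summable_summable]])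
  ultimately have "continuous_on {0..T} (\<lambda>t. F_half dx (R t) (S t) j)"
    by (subst continuous_on_cong[OF refl]) auto
  moreover have inv: "continuous_on UNIV (inv (F_fun c))"
  proof -
    have "(1 / (2 * C1))-lipschitz_on UNIV (inv (F_fun c))"
      using inv_F_fun_lipschitz[OF c] c(2) by (intro lipschitz_onI) (auto simp: dist_real_def)
    then show ?thesis by (rule lipschitz_on_continuous_on)
  qed
  ultimately show ?thesis unfolding u_half_def
    using continuous_on_compose2[OF inv] by blast
qed

section \<open>Discrete entropy inequality and energy bound\<close>

text \<open>The rate at which \<open>h(R) + h(S)\<close> is produced by the quadratic source terms together with the
variation of the wave speed, divided by \<open>c_tilde\<close>.\<close>

definition entropy_production :: "(real \<Rightarrow> real) \<Rightarrow> (real \<Rightarrow> real) \<Rightarrow> real \<Rightarrow> real \<Rightarrow> real" where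
  "entropy_production h h' r s =
     (h' r - h' s) * (r\<^sup>2 - s\<^sup>2) - 2 * (r - s) * (h r - h s)"

lemma sum_int_telescope_zero:
  fixes G :: "int \<Rightarrow> real"
  assumes "G m = 0" "G (n + 1) = 0"
  shows "(\<Sum>j=m..n. G (j + 1) - G j) = 0"
proof -
  have "(\<Sum>j=m..n. G (j + 1)) = (\<Sum>j=m + 1..n + 1. G j)"
    by (rule sum.reindex_bij_witness[of _ "\<lambda>j. j - 1" "\<lambda>j. j + 1"]) auto
  also have "\<dots> = (\<Sum>j=m..n + 1. G j)"
  proof (intro sum.mono_neutral_left ballI)
    fix i assume "i \<in> {m..n + 1} - {m + 1..n + 1}"
    then have "i = m" by auto
    then show "G i = 0" using assms by simp
  qed auto
  also have "\<dots> = (\<Sum>j=m..n. G j)"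
  proof (intro sum.mono_neutral_right ballI)
    fix i assume "i \<in> {m..n + 1} - {m..n}"
    then have "i = n + 1" by auto
    then show "G i = 0" using assms by simp
  qed auto
  finally show ?thesis by (simp add: sum_subtractf)
qed

text \<open>Summation by parts: the weight vanishes at both ends, so the differences move onto it.\<close>

lemma abs_sum_parts_forward_le:
  fixes \<phi> X :: "int \<Rightarrow> real"
  assumes "\<And>j. j \<le> m \<or> n \<le> j \<Longrightarrow> \<phi> j = 0" "\<And>j. \<bar>\<phi> (j + 1) - \<phi> j\<bar> \<le> \<mu>"
  shows "\<bar>\<Sum>j=m..n. \<phi> j * (X (j + 1) - X j)\<bar> \<le> \<mu> * (\<Sum>j=m..n. \<bar>X j\<bar>)"
proof -
  define G where "G j = \<phi> (j - 1) * X j" for j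
  have "(\<Sum>j=m..n. \<phi> j * (X (j + 1) - X j)) = (\<Sum>j=m..n. G (j + 1) - G j) + (\<Sum>j=m..n. (\<phi> (j - 1) - \<phi> j) * X j)"
    unfolding sum.distrib[symmetric] by (rule sum.cong) (auto simp: G_def algebra_simps)
  also have "(\<Sum>j=m..n. G (j + 1) - G j) = 0"
    by (rule sum_int_telescope_zero) (auto simp: G_def assms(1))
  finally have "\<bar>\<Sum>j=m..n. \<phi> j * (X (j + 1) - X j)\<bar> = \<bar>\<Sum>j=m..n. (\<phi> (j - 1) - \<phi> j) * X j\<bar>" by simp
  also have "\<dots> \<le> (\<Sum>j=m..n. \<bar>(\<phi> (j - 1) - \<phi> j) * X j\<bar>)" by (rule sum_abs)
  also have "\<dots> \<le> (\<Sum>j=m..n. \<mu> * \<bar>X j\<bar>)"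
  proof (rule sum_mono)
    fix j show "\<bar>(\<phi> (j - 1) - \<phi> j) * X j\<bar> \<le> \<mu> * \<bar>X j\<bar>"
      using assms(2)[of "j - 1"] unfolding abs_mult by (intro mult_right_mono) (auto simp: abs_minus_commute)
  qed
  finally show ?thesis by (simp add: sum_distrib_left)
qed

lemma abs_sum_parts_backward_le:
  fixes \<phi> Y :: "int \<Rightarrow> real"
  assumes "\<And>j. j \<le> m \<or> n \<le> j \<Longrightarrow> \<phi> j = 0" "\<And>j. \<bar>\<phi> (j + 1) - \<phi> j\<bar> \<le> \<mu>"
  shows "\<bar>\<Sum>j=m..n. \<phi> j * (Y (j - 1) - Y j)\<bar> \<le> \<mu> * (\<Sum>j=m..n. \<bar>Y j\<bar>)"
proof -
  have "\<bar>\<Sum>j=-n..-m. \<phi> (- j) * (Y (- (j + 1)) - Y (- j))\<bar> \<le> \<mu> * (\<Sum>j=-n..-m. \<bar>Y (- j)\<bar>)"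
  proof (rule abs_sum_parts_forward_le)
    fix j show "\<bar>\<phi> (- (j + 1)) - \<phi> (- j)\<bar> \<le> \<mu>"
      using assms(2)[of "- j - 1"] by (simp add: abs_minus_commute)
  qed (use assms(1) in auto)
  moreover have "(\<Sum>j=-n..-m. \<phi> (- j) * (Y (- (j + 1)) - Y (- j))) = (\<Sum>j=m..n. \<phi> j * (Y (j - 1) - Y j))"
    by (rule sum.reindex_bij_witness[of _ uminus uminus]) (auto simp: algebra_simps)
  moreover have "(\<Sum>j=-n..-m. \<bar>Y (- j)\<bar>) = (\<Sum>j=m..n. \<bar>Y j\<bar>)"
    by (rule sum.reindex_bij_witness[of _ uminus uminus]) auto
  ultimately show ?thesis by simp
qed

lemma Dplus_c_half:
  assumes "mean_value_points c dx r s ub u1" "\<And>x. c x \<noteq> 0"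
  shows "(c_half c dx r s j - c_half c dx r s (j - 1)) / dx = 2 * c_tilde c ub u1 j * (r j - s j)"
proof -
  have "r j - s j = 2 * c (ub j) * Dplus dx (u_half c dx r s) (j - 1)"
    "Dplus dx (c_half c dx r s) (j - 1) = deriv c (u1 j) * Dplus dx (u_half c dx r s) (j - 1)"
    using assms(1) by (auto simp: mean_value_points_def)
  then show ?thesis using assms(2)[of "ub j"] by (simp add: c_tilde_def Dplus_def)
qed

text \<open>Convexity of \<open>h\<close> turns the chain rule for the upwind differences into an inequality in the
favourable direction: \<open>R\<close> looks to the right and \<open>S\<close> to the left, each against its direction of
propagation. Writing \<open>C j (h (R (j + 1)) - h (R j))\<close> as a flux difference leaves the difference of
\<open>C\<close>, which is a multiple of \<open>c_tilde (R - S)\<close> by the choice of the mean value points. The flux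
differences are summed by parts and see only the slope \<open>\<mu>\<close> of the weight.\<close>

lemma weighted_entropy_inequality:
  assumes sol: "scheme_solution c dx T R S ubar up" and "dx > 0"
    and c: "\<And>x. 0 < c x \<and> c x \<le> C2"
    and h': "\<And>x. x \<in> D \<Longrightarrow> (h has_real_derivative h' x) (at x)"
    and tangent: "\<And>x y. x \<in> D \<Longrightarrow> y \<in> D \<Longrightarrow> h' x * (y - x) \<le> h y - h x"
    and range: "\<And>t j. t \<in> {0..T} \<Longrightarrow> R t j \<in> D \<and> S t j \<in> D"
    and \<phi>: "\<And>j. 0 \<le> \<phi> j" "\<And>j. j \<le> m \<or> n \<le> j \<Longrightarrow> \<phi> j = 0"
      "\<And>j. \<bar>\<phi> (j + 1) - \<phi> j\<bar> \<le> \<mu>"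
    and t: "t \<in> {0..T}"
  shows "\<exists>d. ((\<lambda>t. \<Sum>j=m..n. \<phi> j * (h (R t j) + h (S t j))) has_real_derivative d) (at t within {0..T}) \<and>
     d \<le> (\<Sum>j=m..n. \<phi> j * (c_tilde c (ubar t) (up t) j * entropy_production h h' (R t j) (S t j)))
        + \<mu> / dx * C2 * (\<Sum>j=m..n. \<bar>h (R t j)\<bar> + \<bar>h (S t j)\<bar>)"
proof -
  define C where "C j = c_half c dx (R t) (S t) j" for j
  have C: "0 < C j" "C j \<le> C2" for j using c by (auto simp: C_def c_half_def)
  have l0: "0 \<le> \<mu>" using \<phi>(3)[of 0] by linarith
  define ct where "ct j = c_tilde c (ubar t) (up t) j" for j
  define R' S' where "R' j = C j * Dplus dx (R t) j + ct j * ((R t j)\<^sup>2 - (S t j)\<^sup>2)"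
    and "S' j = - C (j - 1) * Dminus dx (S t) j - ct j * ((R t j)\<^sup>2 - (S t j)\<^sup>2)" for j
  have R': "((\<lambda>s. R s j) has_real_derivative R' j) (at t within {0..T})"
    and S': "((\<lambda>s. S s j) has_real_derivative S' j) (at t within {0..T})" for j
    using sol t unfolding scheme_solution_def R'_def S'_def C_def ct_def by blast+
  have mv: "mean_value_points c dx (R t) (S t) (ubar t) (up t)"
    using sol t by (simp add: scheme_solution_def)
  have dC: "(C j - C (j - 1)) / dx = 2 * ct j * (R t j - S t j)" for j
    unfolding C_def ct_def by (rule Dplus_c_half[OF mv]) (use c in \<open>auto simp: less_le\<close>)
  have Dt: "R t j \<in> D" "S t j \<in> D" for j using range[OF t] by auto
  define X Y where "X j = C (j - 1) * h (R t j)" and "Y j = C j * h (S t j)" for j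
  define d where "d = (\<Sum>j=m..n. \<phi> j * (h' (R t j) * R' j + h' (S t j) * S' j))"
  have "((\<lambda>t. \<Sum>j=m..n. \<phi> j * (h (R t j) + h (S t j))) has_real_derivative d) (at t within {0..T})"
    unfolding d_def
    by (intro DERIV_sum DERIV_cmult DERIV_add DERIV_chain2[OF h'] R' S' Dt)
  moreover have "d \<le> (\<Sum>j=m..n. \<phi> j * (ct j * entropy_production h h' (R t j) (S t j)))
        + \<mu> / dx * C2 * (\<Sum>j=m..n. \<bar>h (R t j)\<bar> + \<bar>h (S t j)\<bar>)"
  proof -
    have step: "h' (R t j) * R' j + h' (S t j) * S' j
       \<le> (X (j + 1) - X j) / dx + (Y (j - 1) - Y j) / dx + ct j * entropy_production h h' (R t j) (S t j)" for j
    proof -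
      have "h' (R t j) * R' j = C j / dx * (h' (R t j) * (R t (j + 1) - R t j)) + ct j * (h' (R t j) * ((R t j)\<^sup>2 - (S t j)\<^sup>2))"
        by (simp add: R'_def Dplus_def algebra_simps diff_divide_distrib)
      also have "C j / dx * (h' (R t j) * (R t (j + 1) - R t j)) \<le> C j / dx * (h (R t (j + 1)) - h (R t j))"
        using C(1)[of j] \<open>dx > 0\<close> by (intro mult_left_mono tangent Dt) auto
      also have "\<dots> = (X (j + 1) - X j) / dx - (C j - C (j - 1)) / dx * h (R t j)"
        using \<open>dx > 0\<close> by (simp add: X_def field_simps)
      finally have 1: "h' (R t j) * R' j \<le> (X (j + 1) - X j) / dx
          - 2 * ct j * (R t j - S t j) * h (R t j) + ct j * (h' (R t j) * ((R t j)\<^sup>2 - (S t j)\<^sup>2))"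
        unfolding dC by simp
      have "h' (S t j) * S' j = C (j - 1) / dx * (h' (S t j) * (S t (j - 1) - S t j)) - ct j * (h' (S t j) * ((R t j)\<^sup>2 - (S t j)\<^sup>2))"
        by (simp add: S'_def Dminus_def algebra_simps add_divide_distrib diff_divide_distrib)
      also have "C (j - 1) / dx * (h' (S t j) * (S t (j - 1) - S t j)) \<le> C (j - 1) / dx * (h (S t (j - 1)) - h (S t j))"
        using C(1)[of "j - 1"] \<open>dx > 0\<close> by (intro mult_left_mono tangent Dt) auto
      also have "\<dots> = (Y (j - 1) - Y j) / dx + (C j - C (j - 1)) / dx * h (S t j)"
        using \<open>dx > 0\<close> by (simp add: Y_def field_simps)
      finally have 2: "h' (S t j) * S' j \<le> (Y (j - 1) - Y j) / dx
          + 2 * ct j * (R t j - S t j) * h (S t j) - ct j * (h' (S t j) * ((R t j)\<^sup>2 - (S t j)\<^sup>2))"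
        unfolding dC by simp
      show ?thesis using add_mono[OF 1 2] by (simp add: entropy_production_def algebra_simps)
    qed
    have "d \<le> (\<Sum>j=m..n. \<phi> j * ((X (j + 1) - X j) / dx + (Y (j - 1) - Y j) / dx + ct j * entropy_production h h' (R t j) (S t j)))"
      unfolding d_def by (intro sum_mono mult_left_mono step \<phi>)
    also have "\<dots> = (\<Sum>j=m..n. \<phi> j * (X (j + 1) - X j)) / dx + (\<Sum>j=m..n. \<phi> j * (Y (j - 1) - Y j)) / dx
        + (\<Sum>j=m..n. \<phi> j * (ct j * entropy_production h h' (R t j) (S t j)))"
      by (simp add: distrib_left sum.distrib sum_divide_distrib)
    also have "(\<Sum>j=m..n. \<phi> j * (X (j + 1) - X j)) / dx \<le> (\<mu> * (C2 * (\<Sum>j=m..n. \<bar>h (R t j)\<bar>))) / dx"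
    proof (rule divide_right_mono)
      have "(\<Sum>j=m..n. \<phi> j * (X (j + 1) - X j)) \<le> \<mu> * (\<Sum>j=m..n. \<bar>X j\<bar>)"
        using abs_sum_parts_forward_le[of m n \<phi> \<mu> X, OF \<phi>(2,3)] by auto
      also have "\<dots> \<le> \<mu> * (C2 * (\<Sum>j=m..n. \<bar>h (R t j)\<bar>))"
        unfolding sum_distrib_left[of C2] X_def abs_mult
        using C by (intro mult_left_mono sum_mono mult_right_mono l0) (auto simp: less_imp_le)
      finally show "(\<Sum>j=m..n. \<phi> j * (X (j + 1) - X j)) \<le> \<mu> * (C2 * (\<Sum>j=m..n. \<bar>h (R t j)\<bar>))" .
    qed (use \<open>dx > 0\<close> in simp)
    also have "(\<Sum>j=m..n. \<phi> j * (Y (j - 1) - Y j)) / dx \<le> (\<mu> * (C2 * (\<Sum>j=m..n. \<bar>h (S t j)\<bar>))) / dx"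
    proof (rule divide_right_mono)
      have "(\<Sum>j=m..n. \<phi> j * (Y (j - 1) - Y j)) \<le> \<mu> * (\<Sum>j=m..n. \<bar>Y j\<bar>)"
        using abs_sum_parts_backward_le[of m n \<phi> \<mu> Y, OF \<phi>(2,3)] by auto
      also have "\<dots> \<le> \<mu> * (C2 * (\<Sum>j=m..n. \<bar>h (S t j)\<bar>))"
        unfolding sum_distrib_left[of C2] Y_def abs_mult
        using C by (intro mult_left_mono sum_mono mult_right_mono l0) (auto simp: less_imp_le)
      finally show "(\<Sum>j=m..n. \<phi> j * (Y (j - 1) - Y j)) \<le> \<mu> * (C2 * (\<Sum>j=m..n. \<bar>h (S t j)\<bar>))" .
    qed (use \<open>dx > 0\<close> in simp)
    finally show ?thesis by (simp add: sum.distrib algebra_simps add_divide_distrib)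
  qed
  ultimately show ?thesis unfolding ct_def by blast
qed

text \<open>Slope \<open>\<mu>\<close> per grid index: \<open>\<mu> = dx\<close> gives a cutoff with unit slope in space, and \<open>\<mu>\<close> tending to
\<open>0\<close> exhausts the whole grid.\<close>

definition trapezoid :: "real \<Rightarrow> int \<Rightarrow> int \<Rightarrow> int \<Rightarrow> real" where
  "trapezoid \<mu> ja jb j = max 0 (min 1 (min (1 + of_int (j - ja) * \<mu>) (1 + of_int (jb - j) * \<mu>)))"

lemma trapezoid_bounds: "0 \<le> trapezoid \<mu> ja jb j" "trapezoid \<mu> ja jb j \<le> 1"
  by (auto simp: trapezoid_def)

lemma trapezoid_eq_1:
  assumes "0 \<le> \<mu>" "ja \<le> j" "j \<le> jb"
  shows "trapezoid \<mu> ja jb j = 1"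
proof -
  have "0 \<le> of_int (j - ja) * \<mu>" "0 \<le> of_int (jb - j) * \<mu>"
    using assms by (auto intro!: mult_nonneg_nonneg)
  then show ?thesis by (simp add: trapezoid_def)
qed

lemma trapezoid_eq_0:
  assumes "1 \<le> of_int p * \<mu>" "0 \<le> \<mu>" "j \<le> ja - p \<or> jb + p \<le> j"
  shows "trapezoid \<mu> ja jb j = 0"
proof -
  have "of_int (j - ja) * \<mu> \<le> - of_int p * \<mu> \<or> of_int (jb - j) * \<mu> \<le> - of_int p * \<mu>"
    using assms(3)
  proof
    assume "j \<le> ja - p"
    then have "of_int (j - ja) \<le> (- of_int p :: real)" by linarith
    from mult_right_mono[OF this assms(2)] show ?thesis ..
  next
    assume "jb + p \<le> j"
    then have "of_int (jb - j) \<le> (- of_int p :: real)" by linarith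
    from mult_right_mono[OF this assms(2)] show ?thesis ..
  qed
  then have "1 + of_int (j - ja) * \<mu> \<le> 0 \<or> 1 + of_int (jb - j) * \<mu> \<le> 0"
    using assms(1) by auto
  then show ?thesis by (auto simp: trapezoid_def)
qed

lemma trapezoid_slope:
  assumes "0 \<le> \<mu>"
  shows "\<bar>trapezoid \<mu> ja jb (j + 1) - trapezoid \<mu> ja jb j\<bar> \<le> \<mu>"
proof -
  have "of_int (j + 1 - ja) * \<mu> = of_int (j - ja) * \<mu> + \<mu>" "of_int (jb - (j + 1)) * \<mu> = of_int (jb - j) * \<mu> - \<mu>"
    by (auto simp: algebra_simps)
  then show ?thesis using assms unfolding trapezoid_def by linarith
qed

text \<open>The derivative of \<open>f\<close> need not be integrable: the mean value theorem is applied to the sum of \<open>f\<close>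
and the primitive of the continuous function \<open>I\<close>.\<close>

lemma deriv_bound_imp_integral_bound:
  fixes f I :: "real \<Rightarrow> real"
  assumes "T > 0" "continuous_on {0..T} I" "t \<in> {0..T}"
    and "\<And>s. s \<in> {0..T} \<Longrightarrow> \<exists>d. (f has_real_derivative d) (at s within {0..T}) \<and> d \<le> M - I s"
  shows "f t + integral {0..t} I \<le> f 0 + M * t"
proof -
  obtain f' where f': "\<And>s. s \<in> {0..T} \<Longrightarrow> (f has_real_derivative f' s) (at s within {0..T})"
    "\<And>s. s \<in> {0..T} \<Longrightarrow> f' s \<le> M - I s"
    using assms(4) by metis
  define g where "g s = f s + integral {0..s} I" for s
  have g': "(g has_real_derivative f' s + I s) (at s within {0..T})" if "s \<in> {0..T}" for s
    unfolding g_def using that by (intro DERIV_add f' integral_has_real_derivative assms(2))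
  have "\<exists>x\<in>{0..t}. g t - g 0 = (*) (f' x + I x) (t - 0)"
  proof (rule mvt_very_simple)
    fix x assume "0 \<le> x" "x \<le> t"
    then have "(g has_real_derivative f' x + I x) (at x within {0..t})"
      using assms(3) by (intro has_field_derivative_subset[OF g']) auto
    then show "(g has_derivative (*) (f' x + I x)) (at x within {0..t})"
      by (simp add: has_field_derivative_def)
  qed (use assms(3) in auto)
  then obtain x where x: "x \<in> {0..t}" "g t - g 0 = (f' x + I x) * t" by auto
  have "(f' x + I x) * t \<le> M * t"
    using f'(2)[of x] x(1) assms(3) by (intro mult_right_mono) auto
  then show ?thesis using x(2) by (simp add: g_def)
qed

text \<open>The entropy inequality for the square, whose production vanishes. The error is
proportional to the slope \<open>1 / N\<close> of the weight times a square sum that is bounded in time by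
continuity in the space of summable sequences, and disappears as \<open>N\<close> tends to infinity.\<close>

lemma energy_bound:
  assumes sol: "scheme_solution c dx T R S ubar up" and "dx > 0" "T > 0"
    and c: "\<And>x. 0 < c x \<and> c x \<le> C2"
    and init: "\<And>J. finite J \<Longrightarrow> dx * (\<Sum>j\<in>J. (R 0 j)\<^sup>2 + (S 0 j)\<^sup>2) \<le> E"
    and t: "t \<in> {0..T}" and J: "finite J"
  shows "dx * (\<Sum>j\<in>J. (R t j)\<^sup>2 + (S t j)\<^sup>2) \<le> E"
proof -
  have l1: "l1_continuous T R" "l1_continuous T S" using sol by (auto simp: scheme_solution_def)
  obtain BR BS where B: "\<And>t J. t \<in> {0..T} \<Longrightarrow> finite J \<Longrightarrow> (\<Sum>j\<in>J. (R t j)\<^sup>2) \<le> BR"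
    "\<And>t J. t \<in> {0..T} \<Longrightarrow> finite J \<Longrightarrow> (\<Sum>j\<in>J. (S t j)\<^sup>2) \<le> BS"
    using l1_bounded_square_sum[OF l1(1)] l1_bounded_square_sum[OF l1(2)] by metis
  define k where "k = Max (insert 0 (abs ` J))"
  have k: "J \<subseteq> {- k..k}"
  proof
    fix j assume "j \<in> J"
    then have "\<bar>j\<bar> \<le> k" unfolding k_def using J by (intro Max_ge) auto
    then show "j \<in> {- k..k}" by auto
  qed
  define M where "M = C2 * (BR + BS) * T"
  have C2: "C2 > 0" using c[of 0] by linarith
  have main: "dx * (\<Sum>j\<in>J. (R t j)\<^sup>2 + (S t j)\<^sup>2) \<le> E + M / real (Suc N)" for N
  proof -
    define \<mu> where "\<mu> = 1 / real (Suc N)"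
    define p where "p = int (Suc N)"
    have \<mu>: "0 < \<mu>" "1 \<le> of_int p * \<mu>" by (auto simp: \<mu>_def p_def)
    define \<phi> where "\<phi> = trapezoid \<mu> (- k) k"
    define m n where "m = - k - p" and "n = k + p"
    define f where "f t = (\<Sum>j=m..n. \<phi> j * ((R t j)\<^sup>2 + (S t j)\<^sup>2))" for t
    have "f t + integral {0..t} (\<lambda>_. 0) \<le> f 0 + (\<mu> / dx * C2 * (BR + BS)) * t"
    proof (rule deriv_bound_imp_integral_bound[OF \<open>T > 0\<close> _ t])
      fix s assume s: "s \<in> {0..T}"
      obtain d where d: "(f has_real_derivative d) (at s within {0..T})"
        "d \<le> (\<Sum>j=m..n. \<phi> j * (c_tilde c (ubar s) (up s) j * entropy_production (\<lambda>x. x\<^sup>2) (\<lambda>x. 2 * x) (R s j) (S s j)))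
          + \<mu> / dx * C2 * (\<Sum>j=m..n. \<bar>(R s j)\<^sup>2\<bar> + \<bar>(S s j)\<^sup>2\<bar>)"
      proof -
        have "2 * x * (y - x) \<le> y\<^sup>2 - x\<^sup>2" for x y :: real
          using zero_le_power2[of "x - y"] by (simp add: power2_eq_square algebra_simps)
        moreover have "((\<lambda>x. x\<^sup>2) has_real_derivative 2 * x) (at x)" for x :: real
          by (auto intro!: derivative_eq_intros)
        ultimately show ?thesis
          using weighted_entropy_inequality[OF sol \<open>dx > 0\<close> c, where D = UNIV and h = "\<lambda>x. x\<^sup>2" and h' = "\<lambda>x. 2 * x"
              and \<phi> = \<phi> and m = m and n = n and \<mu> = \<mu> and t = s]
            trapezoid_bounds trapezoid_slope[of \<mu>] trapezoid_eq_0[OF \<mu>(2)] \<mu>(1) s that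
          unfolding f_def \<phi>_def m_def n_def by force
      qed
      have "(\<Sum>j=m..n. \<bar>(R s j)\<^sup>2\<bar> + \<bar>(S s j)\<^sup>2\<bar>) \<le> BR + BS"
        using B(1)[OF s, of "{m..n}"] B(2)[OF s, of "{m..n}"] by (simp add: sum.distrib)
      then have "\<mu> / dx * C2 * (\<Sum>j=m..n. \<bar>(R s j)\<^sup>2\<bar> + \<bar>(S s j)\<^sup>2\<bar>) \<le> \<mu> / dx * C2 * (BR + BS)"
        using \<mu> \<open>dx > 0\<close> C2 by (intro mult_left_mono) auto
      moreover have "entropy_production (\<lambda>x. x\<^sup>2) (\<lambda>x. 2 * x) r s = 0" for r s
        by (simp add: entropy_production_def algebra_simps)
      ultimately have "d \<le> \<mu> / dx * C2 * (BR + BS)" using d(2) by simp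
      then show "\<exists>d. (f has_real_derivative d) (at s within {0..T}) \<and> d \<le> \<mu> / dx * C2 * (BR + BS) - 0"
        using d(1) by auto
    qed simp
    then have "f t \<le> f 0 + (\<mu> / dx * C2 * (BR + BS)) * t" by simp
    also have "(\<mu> / dx * C2 * (BR + BS)) * t \<le> (\<mu> / dx * C2 * (BR + BS)) * T"
    proof (rule mult_left_mono)
      have "0 \<le> BR" "0 \<le> BS" using B(1)[OF t, of "{}"] B(2)[OF t, of "{}"] by auto
      then show "0 \<le> \<mu> / dx * C2 * (BR + BS)" using \<mu> \<open>dx > 0\<close> C2 by simp
    qed (use t in simp)
    finally have "dx * f t \<le> dx * f 0 + M * \<mu>"
      using mult_left_mono[of "f t" "f 0 + \<mu> / dx * C2 * (BR + BS) * T" dx] \<open>dx > 0\<close>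
      by (simp add: M_def field_simps)
    moreover have "dx * f 0 \<le> E"
    proof -
      have "f 0 \<le> (\<Sum>j=m..n. 1 * ((R 0 j)\<^sup>2 + (S 0 j)\<^sup>2))"
        unfolding f_def \<phi>_def by (intro sum_mono mult_right_mono trapezoid_bounds) auto
      then have "dx * f 0 \<le> dx * (\<Sum>j=m..n. (R 0 j)\<^sup>2 + (S 0 j)\<^sup>2)"
        using \<open>dx > 0\<close> by (intro mult_left_mono) auto
      then show ?thesis using init[of "{m..n}"] by simp
    qed
    moreover have "(\<Sum>j\<in>J. (R t j)\<^sup>2 + (S t j)\<^sup>2) \<le> f t"
    proof -
      have "(\<Sum>j\<in>J. (R t j)\<^sup>2 + (S t j)\<^sup>2) = (\<Sum>j\<in>J. \<phi> j * ((R t j)\<^sup>2 + (S t j)\<^sup>2))"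
        using k \<mu> by (intro sum.cong) (auto simp: \<phi>_def trapezoid_eq_1 subset_eq)
      also have "\<dots> \<le> f t"
        unfolding f_def using k by (intro sum_mono2) (auto simp: m_def n_def p_def \<phi>_def trapezoid_bounds subset_eq intro!: mult_nonneg_nonneg)
      finally show ?thesis .
    qed
    then have "dx * (\<Sum>j\<in>J. (R t j)\<^sup>2 + (S t j)\<^sup>2) \<le> dx * f t" using \<open>dx > 0\<close> by (intro mult_left_mono) auto
    ultimately show ?thesis by (simp add: \<mu>_def)
  qed
  have "(\<lambda>N. E + M * inverse (real (Suc N))) \<longlonglongrightarrow> E + M * 0"
    by (intro tendsto_intros LIMSEQ_inverse_real_of_nat)
  then show ?thesis
    using main by (intro LIMSEQ_le_const[where a = "dx * (\<Sum>j\<in>J. (R t j)\<^sup>2 + (S t j)\<^sup>2)" and x = E]) (auto simp: divide_inverse)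
qed

section \<open>The entropy that controls higher powers\<close>

text \<open>The shift by \<open>K + 1\<close> keeps the base of the power at least \<open>1\<close> for arguments up to \<open>K\<close>, where the
second derivative of the power is at most that of the square.\<close>

definition shifted_entropy :: "real \<Rightarrow> real \<Rightarrow> real \<Rightarrow> real" where
  "shifted_entropy K \<alpha> x = x\<^sup>2 - (K + 1 - x) powr (1 + \<alpha>)"

definition shifted_entropy' :: "real \<Rightarrow> real \<Rightarrow> real \<Rightarrow> real" where
  "shifted_entropy' K \<alpha> x = 2 * x + (1 + \<alpha>) * (K + 1 - x) powr \<alpha>"

lemma DERIV_shifted_entropy:
  "x \<le> K \<Longrightarrow> (shifted_entropy K \<alpha> has_real_derivative shifted_entropy' K \<alpha> x) (at x)"
  unfolding shifted_entropy_def[abs_def] shifted_entropy'_def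
  by (auto intro!: derivative_eq_intros)

lemma DERIV_shifted_entropy':
  "x \<le> K \<Longrightarrow> (shifted_entropy' K \<alpha> has_real_derivative
      2 - (1 + \<alpha>) * \<alpha> * (K + 1 - x) powr (\<alpha> - 1)) (at x)"
  unfolding shifted_entropy'_def[abs_def]
  by (auto intro!: derivative_eq_intros)

lemma shifted_entropy_tangent:
  assumes "0 \<le> \<alpha>" "\<alpha> < 1" "x \<le> K" "y \<le> K"
  shows "shifted_entropy' K \<alpha> x * (y - x) \<le> shifted_entropy K \<alpha> y - shifted_entropy K \<alpha> x"
proof (rule f''_imp_f'[of "{..K}"])
  fix z assume "z \<in> {..K}"
  then have "(K + 1 - z) powr (\<alpha> - 1) \<le> (K + 1 - z) powr 0"
    using assms by (intro powr_mono) auto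
  then have "(K + 1 - z) powr (\<alpha> - 1) \<le> 1" using \<open>z \<in> _\<close> by simp
  moreover have "(1 + \<alpha>) * \<alpha> \<le> 2 * 1" using assms by (intro mult_mono) auto
  ultimately have "(1 + \<alpha>) * \<alpha> * (K + 1 - z) powr (\<alpha> - 1) \<le> 2 * 1"
    using assms by (intro mult_mono) auto
  then show "0 \<le> 2 - (1 + \<alpha>) * \<alpha> * (K + 1 - z) powr (\<alpha> - 1)" by simp
qed (use assms DERIV_shifted_entropy DERIV_shifted_entropy' in auto)

lemma abs_shifted_entropy_le:
  assumes "0 \<le> \<alpha>" "\<alpha> < 1" "x \<le> K"
  shows "\<bar>shifted_entropy K \<alpha> x\<bar> \<le> 3 * x\<^sup>2 + 2 * (K + 1)\<^sup>2"
proof -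
  have "(K + 1 - x) powr (1 + \<alpha>) \<le> (K + 1 - x) powr 2"
    using assms by (intro powr_mono) auto
  also have "\<dots> = (K + 1 - x)\<^sup>2" using assms by (simp add: powr_numeral)
  also have "\<dots> \<le> 2 * (K + 1)\<^sup>2 + 2 * x\<^sup>2"
    using zero_le_power2[of "K + 1 + x"] by (simp add: power2_eq_square algebra_simps)
  finally show ?thesis
    using powr_ge_zero[of "K + 1 - x" "1 + \<alpha>"] zero_le_power2[of x] zero_le_power2[of "K + 1"]
    unfolding shifted_entropy_def abs_le_iff by linarith
qed

text \<open>With \<open>\<rho> = K + 1 - r\<close> and \<open>\<sigma> = K + 1 - s\<close>, minus the production is a sum of three nonnegative terms:
\<open>2 (K + 1) (1 + \<alpha>) (\<rho>\<^sup>\<alpha> - \<sigma>\<^sup>\<alpha>) (\<rho> - \<sigma>)\<close>, which comes from the shift,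
\<open>(1 + \<alpha>) (\<rho> - \<sigma>) (\<rho> \<sigma>\<^sup>\<alpha> - \<sigma> \<rho>\<^sup>\<alpha>)\<close>, nonnegative as \<open>\<alpha> \<le> 1\<close>, and
\<open>(1 - \<alpha>) (\<rho> - \<sigma>) (\<rho> \<rho>\<^sup>\<alpha> - \<sigma> \<sigma>\<^sup>\<alpha>)\<close>. Superadditivity of the power \<open>1 + \<alpha>\<close> bounds the last one
from below.\<close>

lemma shifted_entropy_production:
  assumes "0 \<le> \<alpha>" "\<alpha> < 1" "0 \<le> K" "r \<le> K" "s \<le> K"
  shows "entropy_production (shifted_entropy K \<alpha>) (shifted_entropy' K \<alpha>) r s
     \<le> - (1 - \<alpha>) * \<bar>r - s\<bar> powr (2 + \<alpha>)"
proof -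
  have ordered: "entropy_production (shifted_entropy K \<alpha>) (shifted_entropy' K \<alpha>) r s
     \<le> - (1 - \<alpha>) * \<bar>r - s\<bar> powr (2 + \<alpha>)" if "r \<le> s" "r \<le> K" "s \<le> K" for r s
  proof -
    define \<rho> \<sigma> where "\<rho> = K + 1 - r" and "\<sigma> = K + 1 - s"
    have rs: "r = K + 1 - \<rho>" "s = K + 1 - \<sigma>" by (auto simp: \<rho>_def \<sigma>_def)
    have \<rho>\<sigma>: "1 \<le> \<sigma>" "\<sigma> \<le> \<rho>" using that by (auto simp: \<rho>_def \<sigma>_def)
    define A B where "A = \<rho> powr \<alpha>" and "B = \<sigma> powr \<alpha>"
    have pow: "\<rho> powr (1 + \<alpha>) = \<rho> * A" "\<sigma> powr (1 + \<alpha>) = \<sigma> * B"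
      using \<rho>\<sigma> by (auto simp: powr_add A_def B_def)
    have AB: "B \<le> A" using \<rho>\<sigma> assms by (auto simp: A_def B_def intro: powr_mono2)
    have super: "(\<rho> - \<sigma>) powr (1 + \<alpha>) \<le> \<rho> * A - \<sigma> * B"
    proof -
      have "(\<rho> - \<sigma>) powr (1 + \<alpha>) = (\<rho> - \<sigma>) * (\<rho> - \<sigma>) powr \<alpha>"
        using \<rho>\<sigma> by (cases "\<rho> = \<sigma>") (auto simp: powr_add)
      also have "\<dots> \<le> (\<rho> - \<sigma>) * A"
        using \<rho>\<sigma> assms unfolding A_def by (intro mult_left_mono powr_mono2) auto
      also have "\<dots> \<le> \<rho> * A - \<sigma> * B"
        using AB \<rho>\<sigma> by (simp add: algebra_simps mult_left_mono)
      finally show ?thesis .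
    qed
    have cross: "\<sigma> * A \<le> \<rho> * B"
    proof -
      have "\<sigma> * A = \<sigma> powr \<alpha> * \<rho> powr \<alpha> * \<sigma> powr (1 - \<alpha>)"
        using \<rho>\<sigma> powr_add[of \<sigma> \<alpha> "1 - \<alpha>"] by (simp add: A_def mult_ac)
      also have "\<dots> \<le> \<sigma> powr \<alpha> * \<rho> powr \<alpha> * \<rho> powr (1 - \<alpha>)"
        using \<rho>\<sigma> assms by (intro mult_left_mono powr_mono2) auto
      also have "\<dots> = \<rho> * B"
        using \<rho>\<sigma> powr_add[of \<rho> \<alpha> "1 - \<alpha>"] by (simp add: B_def mult_ac)
      finally show ?thesis .
    qed
    have "entropy_production (shifted_entropy K \<alpha>) (shifted_entropy' K \<alpha>) r s
       = - (2 * (K + 1) * (1 + \<alpha>) * ((A - B) * (\<rho> - \<sigma>)) + (1 - \<alpha>) * ((\<rho> - \<sigma>) * (\<rho> * A - \<sigma> * B))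
           + (1 + \<alpha>) * ((\<rho> - \<sigma>) * (\<rho> * B - \<sigma> * A)))"
    proof -
      have h: "shifted_entropy K \<alpha> r = r\<^sup>2 - \<rho> * A" "shifted_entropy K \<alpha> s = s\<^sup>2 - \<sigma> * B"
        "shifted_entropy' K \<alpha> r = 2 * r + (1 + \<alpha>) * A" "shifted_entropy' K \<alpha> s = 2 * s + (1 + \<alpha>) * B"
        by (simp_all add: shifted_entropy_def shifted_entropy'_def flip: \<rho>_def \<sigma>_def)
           (simp_all add: pow A_def B_def)
      show ?thesis unfolding entropy_production_def h unfolding rs
        by (simp add: power2_eq_square algebra_simps)
    qed
    also have "\<dots> \<le> - ((1 - \<alpha>) * ((\<rho> - \<sigma>) * (\<rho> * A - \<sigma> * B)))"
    proof -
      have "0 \<le> 2 * (K + 1) * (1 + \<alpha>) * ((A - B) * (\<rho> - \<sigma>))"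
        using assms AB \<rho>\<sigma> by (intro mult_nonneg_nonneg) auto
      moreover have "0 \<le> (1 + \<alpha>) * ((\<rho> - \<sigma>) * (\<rho> * B - \<sigma> * A))"
        using assms cross \<rho>\<sigma> by (intro mult_nonneg_nonneg) auto
      ultimately show ?thesis by simp
    qed
    also have "\<dots> \<le> - ((1 - \<alpha>) * ((\<rho> - \<sigma>) * (\<rho> - \<sigma>) powr (1 + \<alpha>)))"
      using assms super \<rho>\<sigma> by (intro le_imp_neg_le mult_left_mono) auto
    also have "(\<rho> - \<sigma>) * (\<rho> - \<sigma>) powr (1 + \<alpha>) = \<bar>r - s\<bar> powr (2 + \<alpha>)"
    proof -
      have "\<bar>r - s\<bar> = \<rho> - \<sigma>" using \<rho>\<sigma> by (simp add: rs)
      moreover have "x * x powr (1 + \<alpha>) = x powr (2 + \<alpha>)" if "0 \<le> x" for x :: real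
        using that powr_add[of x 1 "1 + \<alpha>"] by (cases "x = 0") (auto simp: add.assoc[symmetric])
      ultimately show ?thesis using \<rho>\<sigma> by simp
    qed
    finally show ?thesis by (simp only: mult_minus_left)
  qed
  have sym: "entropy_production h h' r s = entropy_production h h' s r" for h h'
    by (simp add: entropy_production_def algebra_simps)
  show ?thesis
  proof (cases "r \<le> s")
    case True
    then show ?thesis using ordered assms by blast
  next
    case False
    then show ?thesis using ordered[of s r] assms by (simp add: sym abs_minus_commute)
  qed
qed

lemma c_tilde_bounds:
  assumes "C1 > 0" "\<And>x. C1 \<le> c x" "\<And>x. 0 \<le> deriv c x \<and> deriv c x \<le> M1"
  shows "0 \<le> c_tilde c ub u1 j" "c_tilde c ub u1 j \<le> M1 / (4 * C1)"
proof -
  show "0 \<le> c_tilde c ub u1 j"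
    unfolding c_tilde_def using assms(1) assms(2)[of "ub j"] assms(3)[of "u1 j"] by (intro divide_nonneg_nonneg) auto
  show "c_tilde c ub u1 j \<le> M1 / (4 * C1)"
    unfolding c_tilde_def using assms(1) assms(2)[of "ub j"] assms(3)[of "u1 j"] by (intro frac_le) auto
qed

text \<open>In each equation the square of the other unknown carries a nonpositive factor. Without it, \<open>R\<close> and
\<open>S\<close> separately satisfy inequalities of Riccati type with an upwind difference.\<close>

lemma small_initial_bound_persists:
  assumes sol: "scheme_solution c dx T R S ubar up" and "dx > 0"
    and c: "C1 > 0" "\<And>x. C1 \<le> c x" "\<And>x. 0 \<le> deriv c x \<and> deriv c x \<le> M1" and "M1 > 0"
    and \<epsilon>: "\<epsilon> > 0" "M1 / C1 * \<epsilon> * T \<le> 1"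
    and init: "\<And>j. R 0 j < \<epsilon>" "\<And>j. S 0 j < \<epsilon>" and t: "t \<in> {0..T}"
  shows "R t j \<le> 2 * \<epsilon>" "S t j \<le> 2 * \<epsilon>"
proof -
  define \<kappa> where "\<kappa> = M1 / (4 * C1)"
  have \<kappa>: "\<kappa> > 0" "4 * \<kappa> * \<epsilon> * T \<le> 1" using c(1) \<open>M1 > 0\<close> \<epsilon>(2) by (auto simp: \<kappa>_def)
  have l1: "l1_continuous T R" "l1_continuous T S" using sol by (auto simp: scheme_solution_def)
  have der: "((\<lambda>s. R s j) has_real_derivative c_half c dx (R t) (S t) j * Dplus dx (R t) j
             + c_tilde c (ubar t) (up t) j * ((R t j)\<^sup>2 - (S t j)\<^sup>2)) (at t within {0..T})"
    "((\<lambda>s. S s j) has_real_derivative - c_half c dx (R t) (S t) (j - 1) * Dminus dx (S t) j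
             - c_tilde c (ubar t) (up t) j * ((R t j)\<^sup>2 - (S t j)\<^sup>2)) (at t within {0..T})" if "t \<in> {0..T}" for t j
    using sol that by (auto simp: scheme_solution_def)
  have ct: "0 \<le> c_tilde c ub u1 j" "c_tilde c ub u1 j \<le> \<kappa>" for ub u1 j
    unfolding \<kappa>_def using c_tilde_bounds[where c = c, OF c] by auto
  have k: "0 \<le> c_half c dx r s j / dx" for r s j
    using c(1) c(2)[of "u_half c dx r s j"] \<open>dx > 0\<close> by (simp add: c_half_def)
  have quad: "c_tilde c ub u1 j * (x\<^sup>2 - y\<^sup>2) \<le> \<kappa> * x\<^sup>2" for ub u1 j x y
  proof -
    have "c_tilde c ub u1 j * (x\<^sup>2 - y\<^sup>2) \<le> c_tilde c ub u1 j * x\<^sup>2" using ct(1) by (intro mult_left_mono) auto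
    also have "\<dots> \<le> \<kappa> * x\<^sup>2" using ct(2) by (intro mult_right_mono) auto
    finally show ?thesis .
  qed
  show "R t j \<le> 2 * \<epsilon>"
  proof (rule one_sided_comparison[OF l1(1) der(1) _ \<kappa>(1) \<epsilon>(1) \<kappa>(2) init(1) t])
    fix t j
    show "\<exists>i. \<exists>k\<ge>0. c_half c dx (R t) (S t) j * Dplus dx (R t) j
        + c_tilde c (ubar t) (up t) j * ((R t j)\<^sup>2 - (S t j)\<^sup>2) \<le> k * (R t i - R t j) + \<kappa> * (R t j)\<^sup>2"
      using quad[of "ubar t" "up t" j "R t j" "S t j"] k[of "R t" "S t" j]
      by (intro exI[of _ "j + 1"] exI[of _ "c_half c dx (R t) (S t) j / dx"]) (auto simp: Dplus_def)
  qed
  show "S t j \<le> 2 * \<epsilon>"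
  proof (rule one_sided_comparison[OF l1(2) der(2) _ \<kappa>(1) \<epsilon>(1) \<kappa>(2) init(2) t])
    fix t j
    have "- c_half c dx (R t) (S t) (j - 1) * Dminus dx (S t) j
       = c_half c dx (R t) (S t) (j - 1) / dx * (S t (j - 1) - S t j)"
      by (simp add: Dminus_def algebra_simps diff_divide_distrib)
    then show "\<exists>i. \<exists>k\<ge>0. - c_half c dx (R t) (S t) (j - 1) * Dminus dx (S t) j
        - c_tilde c (ubar t) (up t) j * ((R t j)\<^sup>2 - (S t j)\<^sup>2) \<le> k * (S t i - S t j) + \<kappa> * (S t j)\<^sup>2"
      using quad[of "ubar t" "up t" j "S t j" "R t j"] k[of "R t" "S t" "j - 1"]
      by (intro exI[of _ "j - 1"] exI[of _ "c_half c dx (R t) (S t) (j - 1) / dx"]) (auto simp: algebra_simps)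
  qed
qed

text \<open>Below a mesh size \<open>\<delta>\<close> the initial values are at most \<open>\<epsilon> = C1 / (M1 T)\<close>, the largest value
that the comparison admits up to time \<open>T\<close>. Above \<open>\<delta>\<close> a single value is at most \<open>sqrt (E / \<delta>)\<close> by the energy
bound.\<close>

lemma uniform_upper_bound:
  fixes c u0 du0 v0 :: "real \<Rightarrow> real"
  assumes "T > 0" and c: "C1 > 0" "\<And>x. C1 \<le> c x \<and> c x \<le> C2"
      "\<And>x. 0 \<le> deriv c x \<and> deriv c x \<le> M1" "M1 > 0"
    and lip: "L-lipschitz_on UNIV c"
    and u0: "continuous_on UNIV u0" "has_H1_derivative u0 du0" and v0: "L2_fun v0"
    and neg: "AE x in lebesgue. v0 x + c (u0 x) * du0 x \<le> 0" "AE x in lebesgue. v0 x - c (u0 x) * du0 x \<le> 0"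
    and E: "E = 2 * ((LINT x|lebesgue. (v0 x)\<^sup>2) + C2\<^sup>2 * (LINT x|lebesgue. (du0 x)\<^sup>2))"
  shows "\<exists>K\<ge>0. \<forall>dx > 0. \<forall>R S ubar up. scheme_solution c dx T R S ubar up \<longrightarrow>
     scheme_initial c dx u0 du0 v0 R S \<longrightarrow> (\<forall>t\<in>{0..T}. \<forall>j. R t j \<le> K \<and> S t j \<le> K)"
proof -
  have du0: "L2_fun du0" using u0(2) by (simp add: has_H1_derivative_def)
  define \<epsilon> where "\<epsilon> = C1 / (M1 * T)"
  have \<epsilon>: "\<epsilon> > 0" "M1 / C1 * \<epsilon> * T \<le> 1" using assms by (auto simp: \<epsilon>_def)
  define L' where "L' = L + 1"
  have L0: "0 \<le> L" using lip by (rule lipschitz_on_nonneg)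
  have lip': "\<bar>c x - c y\<bar> \<le> L' * \<bar>x - y\<bar>" for x y
  proof -
    have "\<bar>c x - c y\<bar> \<le> L * \<bar>x - y\<bar>" using lipschitz_onD[OF lip, of x y] by (simp add: dist_real_def)
    also have "\<dots> \<le> L' * \<bar>x - y\<bar>" by (intro mult_right_mono) (auto simp: L'_def)
    finally show ?thesis .
  qed
  obtain \<delta> where \<delta>: "\<delta> > 0" "\<And>dx j. 0 < dx \<Longrightarrow> dx < \<delta> \<Longrightarrow> (LINT x:cell dx j|lebesgue. (du0 x)\<^sup>2) < \<epsilon> / L'"
    using integral_cell_uniformly_small[of "\<lambda>x. (du0 x)\<^sup>2" "\<epsilon> / L'"] du0 \<epsilon>(1) L0
    by (auto simp: L2_fun_def L'_def)
  define K where "K = max (2 * \<epsilon>) (sqrt (E / \<delta>))"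
  have "R t j \<le> K \<and> S t j \<le> K"
    if "dx > 0" and sol: "scheme_solution c dx T R S ubar up"
      and ini: "scheme_initial c dx u0 du0 v0 R S" and t: "t \<in> {0..T}" for dx R S ubar up t j
  proof (cases "dx < \<delta>")
    case True
    have "cell_average dx v0 i + s * (c (u0 (of_int i * dx)) * cell_average dx du0 i) < \<epsilon>"
      if "\<bar>s\<bar> = 1" "AE x in lebesgue. v0 x + s * (c (u0 x) * du0 x) \<le> 0" for s i
    proof -
      have "cell_average dx v0 i + s * (c (u0 (of_int i * dx)) * cell_average dx du0 i)
          \<le> L' * (LINT x:cell dx i|lebesgue. (du0 x)\<^sup>2)"
        using L0 that \<open>dx > 0\<close> by (intro initial_one_sided_bound u0 v0 lip') (auto simp: L'_def)
      also have "\<dots> < L' * (\<epsilon> / L')"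
        using \<delta>(2)[OF \<open>dx > 0\<close> True] L0 by (intro mult_strict_left_mono) (auto simp: L'_def)
      also have "\<dots> = \<epsilon>" using L0 by (simp add: L'_def)
      finally show ?thesis .
    qed
    from this[of 1] this[of "-1"] have "R 0 i < \<epsilon>" "S 0 i < \<epsilon>" for i
      using ini neg by (auto simp: scheme_initial_def)
    then have "R t j \<le> 2 * \<epsilon>" "S t j \<le> 2 * \<epsilon>"
      using small_initial_bound_persists[OF sol \<open>dx > 0\<close> c(1) _ c(3) c(4) \<epsilon> _ _ t] c(2) by blast+
    then show ?thesis by (auto simp: K_def)
  next
    case False
    have cpos: "0 < c x \<and> c x \<le> C2" for x using c(1) c(2)[of x] by auto
    have "dx * (\<Sum>i\<in>{j}. (R t i)\<^sup>2 + (S t i)\<^sup>2) \<le> E"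
    proof (rule energy_bound[OF sol \<open>dx > 0\<close> \<open>T > 0\<close> cpos _ t])
      show "dx * (\<Sum>j\<in>J. (R 0 j)\<^sup>2 + (S 0 j)\<^sup>2) \<le> E" if "finite J" for J
        unfolding E using cpos by (intro initial_energy_le[OF ini v0 du0 \<open>dx > 0\<close> that]) (auto simp: less_imp_le)
    qed simp
    moreover have "\<delta> * ((R t j)\<^sup>2 + (S t j)\<^sup>2) \<le> dx * ((R t j)\<^sup>2 + (S t j)\<^sup>2)"
      using False by (intro mult_right_mono) auto
    ultimately have "(R t j)\<^sup>2 + (S t j)\<^sup>2 \<le> E / \<delta>" using \<delta>(1) by (simp add: le_divide_eq mult.commute)
    then have "(R t j)\<^sup>2 \<le> E / \<delta>" "(S t j)\<^sup>2 \<le> E / \<delta>"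
      using zero_le_power2[of "R t j"] zero_le_power2[of "S t j"] by linarith+
    then have "R t j \<le> sqrt (E / \<delta>)" "S t j \<le> sqrt (E / \<delta>)" by (auto intro: real_le_rsqrt)
    then show ?thesis by (auto simp: K_def)
  qed
  moreover have "K \<ge> 0" using \<epsilon>(1) by (simp add: K_def)
  ultimately show ?thesis by blast
qed

lemma dissipation_dominates_difference_quotient:
  assumes mv: "mean_value_points c dx r s ub u1"
    and c: "C1 > 0" "\<And>x. C1 \<le> c x \<and> c x \<le> C2" "\<And>x. 0 \<le> deriv c x" and "0 \<le> \<alpha>" "\<alpha> < 1"
    and P: "P \<le> - (1 - \<alpha>) * \<bar>r j - s j\<bar> powr (2 + \<alpha>)"
  shows "c_tilde c ub u1 j * P \<le> - ((1 - \<alpha>) * (2 * C1) powr (2 + \<alpha>) / (4 * C2) *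
     (deriv c (u1 j) * \<bar>Dplus dx (u_half c dx r s) (j - 1)\<bar> powr (2 + \<alpha>)))"
proof -
  define q where "q = \<bar>Dplus dx (u_half c dx r s) (j - 1)\<bar>"
  have q: "q \<ge> 0" by (simp add: q_def)
  have cb: "0 < c (ub j)" "C1 \<le> c (ub j)" "c (ub j) \<le> C2" using c(1) c(2)[of "ub j"] by auto
  have "r j - s j = 2 * c (ub j) * Dplus dx (u_half c dx r s) (j - 1)"
    using mv by (auto simp: mean_value_points_def)
  then have "\<bar>r j - s j\<bar> = 2 * c (ub j) * q" using cb by (simp add: abs_mult q_def)
  moreover have "2 * C1 * q \<le> 2 * c (ub j) * q" using cb q by (intro mult_right_mono) auto
  ultimately have "(2 * C1 * q) powr (2 + \<alpha>) \<le> \<bar>r j - s j\<bar> powr (2 + \<alpha>)"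
    using c(1) q assms by (intro powr_mono2) auto
  then have 1: "(2 * C1) powr (2 + \<alpha>) * q powr (2 + \<alpha>) \<le> \<bar>r j - s j\<bar> powr (2 + \<alpha>)"
    using c(1) q by (simp add: powr_mult)
  have 2: "deriv c (u1 j) / (4 * C2) \<le> c_tilde c ub u1 j"
    unfolding c_tilde_def using cb c(3)[of "u1 j"] by (intro divide_left_mono) auto
  have ct0: "0 \<le> deriv c (u1 j) / (4 * C2)" using cb c(3)[of "u1 j"] by simp
  have "(deriv c (u1 j) / (4 * C2)) * ((1 - \<alpha>) * ((2 * C1) powr (2 + \<alpha>) * q powr (2 + \<alpha>)))
      \<le> c_tilde c ub u1 j * ((1 - \<alpha>) * \<bar>r j - s j\<bar> powr (2 + \<alpha>))"
    using 1 2 ct0 assms by (intro mult_mono mult_left_mono) auto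
  moreover have "c_tilde c ub u1 j * P \<le> c_tilde c ub u1 j * (- (1 - \<alpha>) * \<bar>r j - s j\<bar> powr (2 + \<alpha>))"
    using 2 ct0 P by (intro mult_left_mono) auto
  ultimately show ?thesis by (simp add: q_def field_simps)
qed

text \<open>The point \<open>up t j\<close> may depend on \<open>t\<close> in any way, but \<open>deriv c (up t j)\<close> enters only
through its product with \<open>D\<^sub>+ u\<close>, which is a difference quotient of \<open>c_half\<close>.\<close>

lemma integrand_continuous_on:
  assumes sol: "scheme_solution c dx T R S ubar up"
    and c: "continuous_on UNIV c" "C1 > 0" "\<And>x. C1 \<le> c x" "\<And>x. 0 \<le> deriv c x" and "0 \<le> \<alpha>" "dx > 0"
  shows "continuous_on {0..T} (\<lambda>t. deriv c (up t j) * \<bar>Dplus dx (u_half c dx (R t) (S t)) (j - 1)\<bar> powr (2 + \<alpha>))"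
proof -
  have l1: "l1_continuous T R" "l1_continuous T S" using sol by (auto simp: scheme_solution_def)
  have u: "continuous_on {0..T} (\<lambda>t. u_half c dx (R t) (S t) i)" for i
    by (rule u_half_continuous_on[OF c(1-3) l1])
  have "continuous_on {0..T} (\<lambda>t. c_half c dx (R t) (S t) i)" for i
    unfolding c_half_def by (rule continuous_on_compose2[OF c(1) u]) auto
  then have "continuous_on {0..T} (\<lambda>t. \<bar>Dplus dx (c_half c dx (R t) (S t)) (j - 1)\<bar> *
      \<bar>Dplus dx (u_half c dx (R t) (S t)) (j - 1)\<bar> powr (1 + \<alpha>))"
    unfolding Dplus_def using u \<open>0 \<le> \<alpha>\<close> \<open>dx > 0\<close>
    by (intro continuous_intros continuous_on_powr') auto
  moreover have "\<bar>Dplus dx (c_half c dx (R t) (S t)) (j - 1)\<bar> * \<bar>Dplus dx (u_half c dx (R t) (S t)) (j - 1)\<bar> powr (1 + \<alpha>)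
     = deriv c (up t j) * \<bar>Dplus dx (u_half c dx (R t) (S t)) (j - 1)\<bar> powr (2 + \<alpha>)" if "t \<in> {0..T}" for t
  proof -
    define q where "q = \<bar>Dplus dx (u_half c dx (R t) (S t)) (j - 1)\<bar>"
    have "Dplus dx (c_half c dx (R t) (S t)) (j - 1) = deriv c (up t j) * Dplus dx (u_half c dx (R t) (S t)) (j - 1)"
      using sol that unfolding scheme_solution_def mean_value_points_def by blast
    then have "\<bar>Dplus dx (c_half c dx (R t) (S t)) (j - 1)\<bar> = deriv c (up t j) * q"
      using c(4) by (simp add: abs_mult q_def)
    moreover have "q * q powr (1 + \<alpha>) = q powr (2 + \<alpha>)"
      using powr_add[of q 1 "1 + \<alpha>"] by (cases "q = 0") (auto simp: q_def add.assoc[symmetric])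
    ultimately show ?thesis by (simp add: q_def)
  qed
  ultimately show ?thesis by (subst continuous_on_cong[OF refl, symmetric]) auto
qed

text \<open>The weighted entropy is bounded by \<open>Q\<close> in terms of the energy and of the physical width
\<open>4 w + 2\<close> of the enlarged window, and so is, up to the factor \<open>C2\<close>, the flux error. Integrating the entropy inequality
over the time interval leaves the production, which dominates the integrand. The assumption
\<open>dx \<le> w\<close> keeps the margin of the weight, which is at least one cell wide, under control.\<close>

lemma local_higher_integrability:
  assumes sol: "scheme_solution c dx T R S ubar up" and "dx > 0" "T > 0" "0 \<le> \<alpha>" "\<alpha> < 1"
    and c: "C1 > 0" "\<And>x. C1 \<le> c x \<and> c x \<le> C2" "\<And>x. 0 \<le> deriv c x" "continuous_on UNIV c"
    and energy: "\<And>t J. t \<in> {0..T} \<Longrightarrow> finite J \<Longrightarrow> dx * (\<Sum>j\<in>J. (R t j)\<^sup>2 + (S t j)\<^sup>2) \<le> E"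
    and K: "K \<ge> 0" "\<And>t j. t \<in> {0..T} \<Longrightarrow> R t j \<le> K \<and> S t j \<le> K"
    and width: "dx \<le> w" "of_int (jb - ja) * dx \<le> w" "ja \<le> jb"
    and Q: "Q = 3 * E + 4 * (K + 1)\<^sup>2 * (4 * w + 2)"
  shows "set_integrable lebesgue {0..T} (\<lambda>t. dx * (\<Sum>j=ja..jb. deriv c (up t j) *
       \<bar>Dplus dx (u_half c dx (R t) (S t)) (j - 1)\<bar> powr (2 + \<alpha>)))"
    and "(LINT t:{0..T}|lebesgue. dx * (\<Sum>j=ja..jb. deriv c (up t j) *
       \<bar>Dplus dx (u_half c dx (R t) (S t)) (j - 1)\<bar> powr (2 + \<alpha>)))
      \<le> (2 + C2 * T) * Q / ((1 - \<alpha>) * (2 * C1) powr (2 + \<alpha>) / (4 * C2))"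
proof -
  have cpos: "0 < c x \<and> c x \<le> C2" for x using c(1) c(2)[of x] by auto
  have C2: "C2 > 0" using cpos[of 0] by linarith
  define \<kappa> where "\<kappa> = (1 - \<alpha>) * (2 * C1) powr (2 + \<alpha>) / (4 * C2)"
  have \<kappa>: "\<kappa> > 0" using assms C2 by (simp add: \<kappa>_def)
  define g where "g t j = deriv c (up t j) * \<bar>Dplus dx (u_half c dx (R t) (S t)) (j - 1)\<bar> powr (2 + \<alpha>)" for t j
  have g0: "0 \<le> g t j" for t j using c(3) by (simp add: g_def)
  define I where "I t = dx * (\<Sum>j=ja..jb. g t j)" for t
  have Icont: "continuous_on {0..T} I"
    unfolding I_def g_def using c(2)
    by (intro continuous_intros integrand_continuous_on[OF sol c(4,1) _ c(3)] assms) auto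
  then have int: "set_integrable lebesgue {0..T} I" by (rule absolutely_integrable_continuous_real)
  then show "set_integrable lebesgue {0..T} (\<lambda>t. dx * (\<Sum>j=ja..jb. deriv c (up t j) *
       \<bar>Dplus dx (u_half c dx (R t) (S t)) (j - 1)\<bar> powr (2 + \<alpha>)))"
    by (simp add: I_def[abs_def] g_def)
  define h h' where "h = shifted_entropy K \<alpha>" and "h' = shifted_entropy' K \<alpha>"
  \<comment> \<open>The weight of slope \<open>dx\<close> per index falls to \<open>0\<close> within \<open>p\<close> indices of the window.\<close>
  define p where "p = \<lceil>1 / dx\<rceil>"
  have p: "1 \<le> of_int p * dx" "of_int p * dx \<le> 1 + dx" "0 < p"
  proof -
    have "1 / dx \<le> of_int p" "of_int p \<le> 1 / dx + 1" unfolding p_def by linarith+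
    then show "1 \<le> of_int p * dx" "of_int p * dx \<le> 1 + dx" using \<open>dx > 0\<close>
      by (auto simp: field_simps)
    show "0 < p" using \<open>dx > 0\<close> by (simp add: p_def)
  qed
  define m n where "m = ja - p" and "n = jb + p"
  define \<phi> where "\<phi> = trapezoid dx ja jb"
  have mn: "dx * real (card {m..n}) \<le> 4 * w + 2"
  proof -
    have "dx * real (card {m..n}) = of_int (jb - ja) * dx + 2 * (of_int p * dx) + dx"
      using width p by (simp add: m_def n_def algebra_simps)
    also have "\<dots> \<le> w + 2 * (1 + w) + w" using width p by (intro add_mono mult_left_mono) auto
    finally show ?thesis by simp
  qed
  have hsum: "dx * (\<Sum>j=m..n. \<bar>h (R t j)\<bar> + \<bar>h (S t j)\<bar>) \<le> Q" if t: "t \<in> {0..T}" for t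
  proof -
    have "(\<Sum>j=m..n. \<bar>h (R t j)\<bar> + \<bar>h (S t j)\<bar>) \<le> (\<Sum>j=m..n. 3 * ((R t j)\<^sup>2 + (S t j)\<^sup>2) + 4 * (K + 1)\<^sup>2)"
    proof (rule sum_mono)
      fix j
      have "\<bar>h (R t j)\<bar> \<le> 3 * (R t j)\<^sup>2 + 2 * (K + 1)\<^sup>2" "\<bar>h (S t j)\<bar> \<le> 3 * (S t j)\<^sup>2 + 2 * (K + 1)\<^sup>2"
        unfolding h_def using K(2)[OF t] assms by (auto intro: abs_shifted_entropy_le)
      then show "\<bar>h (R t j)\<bar> + \<bar>h (S t j)\<bar> \<le> 3 * ((R t j)\<^sup>2 + (S t j)\<^sup>2) + 4 * (K + 1)\<^sup>2" by simp
    qed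
    then have "dx * (\<Sum>j=m..n. \<bar>h (R t j)\<bar> + \<bar>h (S t j)\<bar>) \<le> dx * (\<Sum>j=m..n. 3 * ((R t j)\<^sup>2 + (S t j)\<^sup>2) + 4 * (K + 1)\<^sup>2)"
      using \<open>dx > 0\<close> by (intro mult_left_mono) auto
    also have "\<dots> = 3 * (dx * (\<Sum>j=m..n. (R t j)\<^sup>2 + (S t j)\<^sup>2)) + 4 * (K + 1)\<^sup>2 * (dx * real (card {m..n}))"
      by (simp only: sum.distrib sum_distrib_left[symmetric] sum_constant) (simp add: algebra_simps)
    also have "\<dots> \<le> 3 * E + 4 * (K + 1)\<^sup>2 * (4 * w + 2)"
      using energy[OF t, of "{m..n}"] mn by (intro add_mono mult_left_mono) auto
    finally show ?thesis by (simp add: Q)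
  qed
  define W where "W t = dx * (\<Sum>j=m..n. \<phi> j * (h (R t j) + h (S t j)))" for t
  have Wbound: "\<bar>W t\<bar> \<le> Q" if t: "t \<in> {0..T}" for t
  proof -
    have "\<bar>\<Sum>j=m..n. \<phi> j * (h (R t j) + h (S t j))\<bar> \<le> (\<Sum>j=m..n. \<bar>\<phi> j * (h (R t j) + h (S t j))\<bar>)" by (rule sum_abs)
    also have "\<dots> \<le> (\<Sum>j=m..n. \<bar>h (R t j)\<bar> + \<bar>h (S t j)\<bar>)"
    proof (rule sum_mono)
      fix j
      have "\<bar>\<phi> j * (h (R t j) + h (S t j))\<bar> \<le> 1 * \<bar>h (R t j) + h (S t j)\<bar>"
        unfolding abs_mult \<phi>_def by (intro mult_right_mono) (auto simp: trapezoid_bounds)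
      also have "\<dots> \<le> \<bar>h (R t j)\<bar> + \<bar>h (S t j)\<bar>" by simp
      finally show "\<bar>\<phi> j * (h (R t j) + h (S t j))\<bar> \<le> \<bar>h (R t j)\<bar> + \<bar>h (S t j)\<bar>" .
    qed
    finally have "\<bar>W t\<bar> \<le> dx * (\<Sum>j=m..n. \<bar>h (R t j)\<bar> + \<bar>h (S t j)\<bar>)"
      using \<open>dx > 0\<close> by (simp add: W_def abs_mult mult_left_mono)
    then show ?thesis using hsum[OF t] by simp
  qed
  have "W T + integral {0..T} (\<lambda>t. \<kappa> * I t) \<le> W 0 + (C2 * Q) * T"
  proof (rule deriv_bound_imp_integral_bound[OF \<open>T > 0\<close>])
    show "continuous_on {0..T} (\<lambda>t. \<kappa> * I t)" by (intro continuous_intros Icont)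
    fix t assume t: "t \<in> {0..T}"
    have "\<exists>d. ((\<lambda>t. \<Sum>j=m..n. \<phi> j * (h (R t j) + h (S t j))) has_real_derivative d) (at t within {0..T}) \<and>
     d \<le> (\<Sum>j=m..n. \<phi> j * (c_tilde c (ubar t) (up t) j * entropy_production h h' (R t j) (S t j)))
        + dx / dx * C2 * (\<Sum>j=m..n. \<bar>h (R t j)\<bar> + \<bar>h (S t j)\<bar>)"
    proof (rule weighted_entropy_inequality[OF sol \<open>dx > 0\<close> cpos, where D = "{..K}"])
      show "0 \<le> \<phi> j" for j by (simp add: \<phi>_def trapezoid_bounds)
      show "\<phi> j = 0" if "j \<le> m \<or> n \<le> j" for j
        unfolding \<phi>_def using that \<open>dx > 0\<close> by (intro trapezoid_eq_0[OF p(1)]) (auto simp: m_def n_def)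
      show "\<bar>\<phi> (j + 1) - \<phi> j\<bar> \<le> dx" for j
        unfolding \<phi>_def using \<open>dx > 0\<close> by (intro trapezoid_slope) auto
    qed (use K t assms DERIV_shifted_entropy shifted_entropy_tangent in \<open>auto simp: h_def h'_def\<close>)
    then obtain d where d: "((\<lambda>t. \<Sum>j=m..n. \<phi> j * (h (R t j) + h (S t j))) has_real_derivative d) (at t within {0..T})"
      "d \<le> (\<Sum>j=m..n. \<phi> j * (c_tilde c (ubar t) (up t) j * entropy_production h h' (R t j) (S t j)))
        + C2 * (\<Sum>j=m..n. \<bar>h (R t j)\<bar> + \<bar>h (S t j)\<bar>)"
      using \<open>dx > 0\<close> by auto
    have "(\<Sum>j=m..n. \<phi> j * (c_tilde c (ubar t) (up t) j * entropy_production h h' (R t j) (S t j)))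
       \<le> (\<Sum>j=m..n. \<phi> j * (- (\<kappa> * g t j)))"
    proof (intro sum_mono mult_left_mono)
      fix j
      have mv: "mean_value_points c dx (R t) (S t) (ubar t) (up t)" using sol t by (simp add: scheme_solution_def)
      have "entropy_production h h' (R t j) (S t j) \<le> - (1 - \<alpha>) * \<bar>R t j - S t j\<bar> powr (2 + \<alpha>)"
        unfolding h_def h'_def using K(1) K(2)[OF t] assms by (intro shifted_entropy_production) auto
      from dissipation_dominates_difference_quotient[OF mv c(1-3) \<open>0 \<le> \<alpha>\<close> \<open>\<alpha> < 1\<close> this]
      show "c_tilde c (ubar t) (up t) j * entropy_production h h' (R t j) (S t j) \<le> - (\<kappa> * g t j)"
        by (simp add: \<kappa>_def g_def)
    qed (simp add: \<phi>_def trapezoid_bounds)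
    also have "\<dots> = - (\<kappa> * (\<Sum>j=m..n. \<phi> j * g t j))"
      by (simp add: sum_distrib_left sum_negf mult_ac)
    also have "\<dots> \<le> - (\<kappa> * (\<Sum>j=ja..jb. g t j))"
    proof -
      have "(\<Sum>j=ja..jb. g t j) = (\<Sum>j=ja..jb. \<phi> j * g t j)"
        using \<open>dx > 0\<close> by (intro sum.cong) (auto simp: \<phi>_def trapezoid_eq_1)
      also have "\<dots> \<le> (\<Sum>j=m..n. \<phi> j * g t j)"
        using p(3) g0 by (intro sum_mono2) (auto simp: m_def n_def \<phi>_def trapezoid_bounds)
      finally show ?thesis using \<kappa> by (simp add: mult_left_mono)
    qed
    finally have "dx * d \<le> dx * (- (\<kappa> * (\<Sum>j=ja..jb. g t j)) + C2 * (\<Sum>j=m..n. \<bar>h (R t j)\<bar> + \<bar>h (S t j)\<bar>))"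
      using d(2) \<open>dx > 0\<close> by (intro mult_left_mono) auto
    also have "\<dots> = C2 * (dx * (\<Sum>j=m..n. \<bar>h (R t j)\<bar> + \<bar>h (S t j)\<bar>)) - \<kappa> * I t"
      by (simp add: I_def algebra_simps)
    also have "\<dots> \<le> C2 * Q - \<kappa> * I t"
      using hsum[OF t] C2 by (intro diff_right_mono mult_left_mono) auto
    finally show "\<exists>d. (W has_real_derivative d) (at t within {0..T}) \<and> d \<le> C2 * Q - \<kappa> * I t"
      using DERIV_cmult[OF d(1), of dx] unfolding W_def by blast
  qed (use \<open>T > 0\<close> in auto)
  moreover have "integral {0..T} (\<lambda>t. \<kappa> * I t) = \<kappa> * integral {0..T} I"
    by simp
  ultimately have "\<kappa> * integral {0..T} I \<le> (2 + C2 * T) * Q"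
    using Wbound[of 0] Wbound[of T] \<open>T > 0\<close> by (simp add: algebra_simps)
  then have "integral {0..T} I \<le> (2 + C2 * T) * Q / \<kappa>"
    using \<kappa> by (simp add: le_divide_eq mult.commute)
  moreover have "(LINT t:{0..T}|lebesgue. I t) = integral {0..T} I"
    by (rule set_lebesgue_integral_eq_integral(2)[OF int])
  ultimately show "(LINT t:{0..T}|lebesgue. dx * (\<Sum>j=ja..jb. deriv c (up t j) *
       \<bar>Dplus dx (u_half c dx (R t) (S t)) (j - 1)\<bar> powr (2 + \<alpha>)))
      \<le> (2 + C2 * T) * Q / ((1 - \<alpha>) * (2 * C1) powr (2 + \<alpha>) / (4 * C2))"
    by (simp add: I_def g_def \<kappa>_def)
qed

theorem lemmaA1:
  fixes T a b \<alpha> C1 C2 M1 :: real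
    and c u0 du0 v0 R0 S0 :: "real \<Rightarrow> real"
  assumes "T > 0" and "a < b" and "0 \<le> \<alpha>" and "\<alpha> < 1"
    and "C1 > 0" and "C2 > 0" and "M1 > 0"
    and "\<exists>L. L-lipschitz_on UNIV c"
    and "\<And>x. c differentiable (at x)"
    and "\<And>x. C1 \<le> c x \<and> c x \<le> C2"
    and "\<And>x. 0 \<le> deriv c x \<and> deriv c x \<le> M1"
    and "continuous_on UNIV u0"
    and "has_H1_derivative u0 du0"
    and "L2_fun v0"
    and "R0 = (\<lambda>x. v0 x + c (u0 x) * du0 x)"
    and "S0 = (\<lambda>x. v0 x - c (u0 x) * du0 x)"
    and "AE x in lebesgue. R0 x \<le> 0"
    and "AE x in lebesgue. S0 x \<le> 0"
    and "L1_fun R0" and "L2_fun R0"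
    and "L1_fun S0" and "L2_fun S0"
  shows "\<exists>C::real. \<forall>dx > 0. \<forall>R S ubar up. \<forall>ja jb :: int.
    scheme_solution c dx T R S ubar up \<longrightarrow>
    scheme_initial c dx u0 du0 v0 R S \<longrightarrow>
    a - 1 \<le> of_int ja * dx \<longrightarrow> of_int ja * dx < a \<longrightarrow>
    b < of_int jb * dx \<longrightarrow> of_int jb * dx \<le> b + 1 \<longrightarrow>
    set_integrable lebesgue {0..T} (\<lambda>t. dx * (\<Sum>j=ja..jb. deriv c (up t j) *
       \<bar>Dplus dx (u_half c dx (R t) (S t)) (j - 1)\<bar> powr (2 + \<alpha>))) \<and>
    (LINT t:{0..T}|lebesgue. dx * (\<Sum>j=ja..jb. deriv c (up t j) *
       \<bar>Dplus dx (u_half c dx (R t) (S t)) (j - 1)\<bar> powr (2 + \<alpha>))) \<le> C"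
proof -
  obtain L where L: "L-lipschitz_on UNIV c" using assms(8) by blast
  have cont: "continuous_on UNIV c" using L by (rule lipschitz_on_continuous_on)
  have du0: "L2_fun du0" using assms(13) by (simp add: has_H1_derivative_def)
  define E where "E = 2 * ((LINT x|lebesgue. (v0 x)\<^sup>2) + C2\<^sup>2 * (LINT x|lebesgue. (du0 x)\<^sup>2))"
  have neg: "AE x in lebesgue. v0 x + c (u0 x) * du0 x \<le> 0" "AE x in lebesgue. v0 x - c (u0 x) * du0 x \<le> 0"
    using assms(15-18) by auto
  obtain K where K: "K \<ge> 0" "\<And>dx R S ubar up t j. dx > 0 \<Longrightarrow> scheme_solution c dx T R S ubar up \<Longrightarrow>
     scheme_initial c dx u0 du0 v0 R S \<Longrightarrow> t \<in> {0..T} \<Longrightarrow> R t j \<le> K \<and> S t j \<le> K"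
    using uniform_upper_bound[OF assms(1,5,10,11,7) L assms(12,13,14) neg E_def] by blast
  define w where "w = b - a + 2"
  define Q where "Q = 3 * E + 4 * (K + 1)\<^sup>2 * (4 * w + 2)"
  show ?thesis
  proof (rule exI[of _ "(2 + C2 * T) * Q / ((1 - \<alpha>) * (2 * C1) powr (2 + \<alpha>) / (4 * C2))"],
      intro allI impI)
    fix dx :: real and R S ubar up and ja jb :: int
    assume dx: "dx > 0" and sol: "scheme_solution c dx T R S ubar up"
      and ini: "scheme_initial c dx u0 du0 v0 R S"
      and j: "a - 1 \<le> of_int ja * dx" "of_int ja * dx < a" "b < of_int jb * dx" "of_int jb * dx \<le> b + 1"
    have "of_int ja * dx < of_int jb * dx" using j \<open>a < b\<close> by linarith
    then have "ja < jb" using dx by simp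
    have w: "of_int (jb - ja) * dx \<le> w" using j by (simp add: w_def algebra_simps)
    \<comment> \<open>The window contains two distinct grid points, so it also bounds the mesh size.\<close>
    have "1 * dx \<le> of_int (jb - ja) * dx" using \<open>ja < jb\<close> dx by (intro mult_right_mono) auto
    then have "dx \<le> w" using w by simp
    have cpos: "0 < c x \<and> c x \<le> C2" for x using assms(5) assms(10)[of x] by auto
    have energy: "dx * (\<Sum>j\<in>J. (R t j)\<^sup>2 + (S t j)\<^sup>2) \<le> E" if "t \<in> {0..T}" "finite J" for t J
    proof (rule energy_bound[OF sol dx assms(1) cpos _ that])
      show "dx * (\<Sum>j\<in>J. (R 0 j)\<^sup>2 + (S 0 j)\<^sup>2) \<le> E" if "finite J" for J
        unfolding E_def using cpos
        by (intro initial_energy_le[OF ini assms(14) du0 dx that]) (auto simp: less_imp_le)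
    qed
    note result = local_higher_integrability[OF sol dx assms(1,3,4,5,10) _ cont energy K(1) K(2)[OF dx sol ini]
        \<open>dx \<le> w\<close> w less_imp_le[OF \<open>ja < jb\<close>] Q_def]
    show "set_integrable lebesgue {0..T} (\<lambda>t. dx * (\<Sum>j=ja..jb. deriv c (up t j) *
       \<bar>Dplus dx (u_half c dx (R t) (S t)) (j - 1)\<bar> powr (2 + \<alpha>))) \<and>
     (LINT t:{0..T}|lebesgue. dx * (\<Sum>j=ja..jb. deriv c (up t j) *
       \<bar>Dplus dx (u_half c dx (R t) (S t)) (j - 1)\<bar> powr (2 + \<alpha>)))
      \<le> (2 + C2 * T) * Q / ((1 - \<alpha>) * (2 * C1) powr (2 + \<alpha>) / (4 * C2))"
      by (intro conjI result) (use assms(11) in auto)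
  qed
qed

end
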